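(* Let $\Gamma$ be a locally finite connected graph and let $\{\xi_i\}_{i=1}^\infty$ be a sequence of i.i.d. random $\Gamma$-elements. If the weight function $M_{\xi_1}$ is totally defined and $2\le|\mathbb{E}(\xi_1)|\le3$, then $$\limsup_{n\to\infty}\mathbb{S}_n=\mathbb{E}(\xi_1)$$ holds with probability one.
   Context: Let $(\Omega,\mathcal{F},\mathbf{P})$ be a probability space and let $d$ be the graph distance on $V(\Gamma)$. A random $\Gamma$-element is a measurable function $\xi:\Omega\to V(\Gamma)$ (with $V(\Gamma)$ discrete); its distribution is $\mu_\xi(v)=\mathbf{P}(\xi=v)$. The weight function is $M_\xi(v)=\sum_{s\in V(\Gamma)}d^2(v,s)\mu_\xi(s)$; it is totally defined if $M_\xi(v)<\infty$ for all $v\in V(\Gamma)$. In that case the mean-set of $\xi$ is $\mathbb{E}(\xi)=\{v\in V(\Gamma)\mid M_\xi(v)\le M_\xi(u)\ \forall u\in V(\Gamma)\}$. For a sample $\xi_1,\dots,\xi_n$ put $\mu_n(u)=\frac1n|\{i\mid 1\le i\le n,\ \xi_i=u\}|$ and $M_n(v)=\sum_{s\in V(\Gamma)}d^2(v,s)\mu_n(s)$. The sample mean-set is $\mathbb{S}_n=\mathbb{S}(\xi_1,\dots,\xi_n)=\{v\in V(\Gamma)\mid M_n(v)\le M_n(u)\ \forall u\in V(\Gamma)\}$. For a sequence of sets, $\limsup_n A_n$ is the set of points lying in $A_n$ for infinitely many $n$. *)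

theory Defs
  imports "HOL-Probability.Probability"
begin

text \<open>
  An undirected graph is a vertex set with a symmetric adjacency relation. Loops are allowed, and
  parallel edges are not represented; neither has any influence on the graph distance.
\<close>

definition graph :: "'v set \<Rightarrow> 'v rel \<Rightarrow> bool" where
  "graph V E \<longleftrightarrow> E \<subseteq> V \<times> V \<and> sym E"

definition locally_finite_graph :: "'v set \<Rightarrow> 'v rel \<Rightarrow> bool" where
  "locally_finite_graph V E \<longleftrightarrow> (\<forall>v\<in>V. finite (E `` {v}))"

definition connected_graph :: "'v set \<Rightarrow> 'v rel \<Rightarrow> bool" where
  "connected_graph V E \<longleftrightarrow> (\<forall>u\<in>V. \<forall>v\<in>V. (u, v) \<in> E\<^sup>*)"

text \<open>
  \<open>(u, v) \<in> E ^^ n\<close> says that there is a walk with \<open>n\<close> edges from \<open>u\<close> to \<open>v\<close>. The value is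
  meaningful only if \<open>u\<close> and \<open>v\<close> are joined by a walk.
\<close>

definition graph_dist :: "'v rel \<Rightarrow> 'v \<Rightarrow> 'v \<Rightarrow> nat" where
  "graph_dist E u v = (LEAST n. (u, v) \<in> E ^^ n)"

definition distribution :: "'a measure \<Rightarrow> ('a \<Rightarrow> 'v) \<Rightarrow> 'v \<Rightarrow> real" where
  "distribution P \<xi> v = measure P {\<omega> \<in> space P. \<xi> \<omega> = v}"

text \<open>
  The relative frequency \<open>\<mu>\<^sub>n\<close> of \<open>u\<close> in the sample \<open>x 1, \<dots>, x n\<close>; the value \<open>x 0\<close> is not used.
\<close>

definition sample_distribution :: "(nat \<Rightarrow> 'v) \<Rightarrow> nat \<Rightarrow> 'v \<Rightarrow> real" where
  "sample_distribution x n u = real (card {i. 1 \<le> i \<and> i \<le> n \<and> x i = u}) / real n"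

text \<open>
  The weight function takes values in \<open>[0, \<infinity>]\<close>, where every sum exists. Both \<open>M\<^sub>\<xi>\<close> and the sampling
  weight \<open>M\<^sub>n\<close> are instances, for \<open>\<mu> = \<mu>\<^sub>\<xi>\<close> and \<open>\<mu> = \<mu>\<^sub>n\<close>, and likewise for the mean-set below.
\<close>

definition weight :: "'v set \<Rightarrow> 'v rel \<Rightarrow> ('v \<Rightarrow> real) \<Rightarrow> 'v \<Rightarrow> ennreal" where
  "weight V E \<mu> v = (\<Sum>\<^sub>\<infinity>s\<in>V. ennreal ((real (graph_dist E v s))\<^sup>2 * \<mu> s))"

definition totally_defined :: "'v set \<Rightarrow> 'v rel \<Rightarrow> ('v \<Rightarrow> real) \<Rightarrow> bool" where
  "totally_defined V E \<mu> \<longleftrightarrow> (\<forall>v\<in>V. weight V E \<mu> v < \<infinity>)"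

definition minimizers :: "'v set \<Rightarrow> 'v rel \<Rightarrow> ('v \<Rightarrow> real) \<Rightarrow> 'v set" where
  "minimizers V E \<mu> = {v \<in> V. \<forall>u\<in>V. weight V E \<mu> v \<le> weight V E \<mu> u}"

definition mean_set :: "'v set \<Rightarrow> 'v rel \<Rightarrow> 'a measure \<Rightarrow> ('a \<Rightarrow> 'v) \<Rightarrow> 'v set" where
  "mean_set V E P \<xi> = minimizers V E (distribution P \<xi>)"

definition sample_mean_set :: "'v set \<Rightarrow> 'v rel \<Rightarrow> (nat \<Rightarrow> 'v) \<Rightarrow> nat \<Rightarrow> 'v set" where
  "sample_mean_set V E x n = minimizers V E (sample_distribution x n)"

text \<open>
  The upper limit of a sequence of sets is the library's \<^const>\<open>limsup\<close> in the complete lattice of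
  sets; the following lemma gives its pointwise meaning.
\<close>

lemma mem_limsup_iff: "x \<in> limsup A \<longleftrightarrow> infinite {n. x \<in> A n}"
  for A :: "nat \<Rightarrow> 'v set"
  by (auto simp: limsup_INF_SUP infinite_nat_iff_unbounded_le)

end

theory Submission
  imports Defs "HOL-Library.Discrete_Functions"
begin

text \<open>
  Write \<open>Q n v\<close> for the sum of the squared distances from \<open>v\<close> to the first \<open>n\<close> sample points; the sample
  mean-set consists of the minimizers of \<open>Q n\<close>. By the strong law of large numbers \<open>Q n v / n\<close> tends to
  the weight of \<open>v\<close>. So a vertex outside the mean-set is eventually worse than the points of the mean-set,
  and in fact all such vertices are simultaneously so from some time on: the distant ones are excluded
  by a uniform estimate from the triangle inequality, and only finitely many others remain
  (\<open>eventually_minimizers_dominate\<close>). In particular the upper limit is contained in the mean-set.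

  For the other inclusion let the mean-set be \<open>{v1, v2, v3}\<close>, possibly with repetitions. The differences
  \<open>Q n v2 - Q n v1\<close> and \<open>Q n v3 - Q n v1\<close> are the coordinates of a random walk in the integer plane. Its
  steps are centred because the weights of the three vertices agree, and they are square integrable
  because the difference of two squared distances grows only linearly in the distance. Such a walk is
  recurrent, hence almost surely all three sums agree infinitely often
  (\<open>ties_infinitely_often\<close>). At such a time, if it is late enough, the sample mean-set is the whole
  mean-set.

  Recurrence is proved by the method of Chung and Fuchs
  (\<open>not_summable_return_probabilities\<close>). If \<open>\<phi>\<close> is the characteristic function of the step and \<open>p n\<close>
  the probability of being at the origin at time \<open>n\<close>, Fourier inversion gives
  \<open>4 * pi\<^sup>2 * (\<Sum>n. r ^ n * p n)\<close> as the integral of the real part of \<open>1 / (1 - r * \<phi>)\<close> over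
  the square \<open>[- pi, pi]\<^sup>2\<close>. As \<open>r\<close> tends to \<open>1\<close>, the integrand is of order at least
  \<open>1 / h\<^sup>2\<close> at frequencies of size \<open>h\<close> in a suitable cone of directions, and in dimension two the
  integral of this over all dyadic scales diverges. So the return probabilities are not summable, and
  a decomposition at the last visit to the origin shows that there are infinitely many visits
  (\<open>walk_zero_infinitely_often\<close>).
\<close>

section \<open>Walks along an i.i.d. sequence\<close>

definition walk :: "('a \<Rightarrow> 'b::comm_monoid_add) \<Rightarrow> (nat \<Rightarrow> 'a) \<Rightarrow> nat \<Rightarrow> 'b" where
  "walk h \<omega> n = (\<Sum>i<n. h (\<omega> i))"

lemma walk_0 [simp]: "walk h \<omega> 0 = 0"
  by (simp add: walk_def)

lemma walk_Suc_case_nat: "walk h (case_nat s \<omega>) (Suc n) = h s + walk h \<omega> n"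
  unfolding walk_def by (subst sum.lessThan_Suc_shift) simp

lemma walk_comb_seq:
  "k \<le> n \<Longrightarrow> walk h (comb_seq n \<omega> \<omega>') k = walk h \<omega> k"
  "walk h (comb_seq n \<omega> \<omega>') (n + k) = walk h \<omega> n + walk h \<omega>' k"
proof -
  show 1: "walk h (comb_seq n \<omega> \<omega>') k = walk h \<omega> k" if "k \<le> n" for k
    unfolding walk_def using that by (intro sum.cong) (auto simp: comb_seq_def)
  show "walk h (comb_seq n \<omega> \<omega>') (n + k) = walk h \<omega> n + walk h \<omega>' k"
  proof (induction k)
    case 0
    then show ?case by (simp add: 1)
  next
    case (Suc k)
    then show ?case by (simp add: walk_def comb_seq_def add.assoc)
  qed
qed

lemma measurable_walk [measurable]:
  fixes h :: "'a \<Rightarrow> 'b::{second_countable_topology, real_normed_vector}"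
  assumes [measurable]: "h \<in> borel_measurable M"
  shows "(\<lambda>\<omega>. walk h \<omega> n) \<in> borel_measurable (\<Pi>\<^sub>M i\<in>(UNIV::nat set). M)"
  unfolding walk_def by measurable

text \<open>
  \<open>PiM_iter\<close> in the form in which it is used: prepending an independent coordinate to the sequence
  does not change its law, so moments of a walk can be computed by induction on the number of steps.
\<close>

lemma (in sequence_space) integral_case_nat:
  fixes F :: "(nat \<Rightarrow> 'a) \<Rightarrow> 'b::{banach, second_countable_topology}"
  assumes [measurable]: "F \<in> borel_measurable S"
  shows "(\<integral>\<omega>. F \<omega> \<partial>S) = (\<integral>p. F (case_nat (fst p) (snd p)) \<partial>(M \<Otimes>\<^sub>M S))"
    and "integrable S F \<longleftrightarrow> integrable (M \<Otimes>\<^sub>M S) (\<lambda>p. F (case_nat (fst p) (snd p)))"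
proof -
  have "(\<integral>\<omega>. F \<omega> \<partial>S) = (\<integral>\<omega>. F \<omega> \<partial>distr (M \<Otimes>\<^sub>M S) S (\<lambda>(s, \<omega>). case_nat s \<omega>))"
    by (simp only: PiM_iter)
  also have "\<dots> = (\<integral>p. F (case_nat (fst p) (snd p)) \<partial>(M \<Otimes>\<^sub>M S))"
    by (subst integral_distr) (auto simp: case_prod_beta)
  finally show "(\<integral>\<omega>. F \<omega> \<partial>S) = (\<integral>p. F (case_nat (fst p) (snd p)) \<partial>(M \<Otimes>\<^sub>M S))" .
  have "integrable S F \<longleftrightarrow> integrable (distr (M \<Otimes>\<^sub>M S) S (\<lambda>(s, \<omega>). case_nat s \<omega>)) F"
    by (simp only: PiM_iter)
  also have "\<dots> \<longleftrightarrow> integrable (M \<Otimes>\<^sub>M S) (\<lambda>p. F (case_nat (fst p) (snd p)))"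
    by (subst integrable_distr_eq) (auto simp: case_prod_beta)
  finally show "integrable S F \<longleftrightarrow> integrable (M \<Otimes>\<^sub>M S) (\<lambda>p. F (case_nat (fst p) (snd p)))" .
qed

text \<open>
  The Markov property at a fixed time: an event that splits into a condition on the first \<open>n\<close>
  coordinates and one on the shifted remainder has the product of the two probabilities.
\<close>

lemma (in sequence_space) prob_S_comb_seq:
  assumes [measurable]: "A \<in> sets S" "B \<in> sets S" "C \<in> sets S"
    and C: "\<And>\<omega> \<omega>'. \<omega> \<in> space S \<Longrightarrow> \<omega>' \<in> space S \<Longrightarrow> comb_seq n \<omega> \<omega>' \<in> C \<longleftrightarrow> \<omega> \<in> A \<and> \<omega>' \<in> B"
  shows "measure S C = measure S A * measure S B"
proof -
  have "emeasure S C = emeasure (distr (S \<Otimes>\<^sub>M S) S (\<lambda>(\<omega>, \<omega>'). comb_seq n \<omega> \<omega>')) C"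
    by (simp only: PiM_comb_seq)
  also have "\<dots> = emeasure (S \<Otimes>\<^sub>M S) ((\<lambda>(\<omega>, \<omega>'). comb_seq n \<omega> \<omega>') -` C \<inter> space (S \<Otimes>\<^sub>M S))"
    by (rule emeasure_distr) (auto intro: measurable_comb_seq)
  also have "(\<lambda>(\<omega>, \<omega>'). comb_seq n \<omega> \<omega>') -` C \<inter> space (S \<Otimes>\<^sub>M S) = A \<times> B"
    using C sets.sets_into_space[of A S] sets.sets_into_space[of B S]
    by (fastforce simp: space_pair_measure)
  also have "emeasure (S \<Otimes>\<^sub>M S) (A \<times> B) = emeasure S A * emeasure S B"
    by (rule P.emeasure_pair_measure_Times) auto
  finally show ?thesis
    by (simp add: measure_def enn2real_mult)
qed

text \<open>
  Decompose at the last visit to the origin. Let \<open>p n\<close> be the probability to be at \<open>0\<close> at time \<open>n\<close>, and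
  \<open>q N\<close> that of staying away from \<open>0\<close> during the first \<open>N\<close> steps. The events "at \<open>0\<close> at time \<open>n\<close>, and not again during the
  next \<open>N\<close> steps" are disjoint for \<open>n < N\<close>, and by the Markov property they have probability
  \<open>p n * q N\<close>. Hence \<open>(\<Sum>n<N. p n) * q N \<le> 1\<close>; as the sum diverges, \<open>q N\<close> tends to \<open>0\<close>, so almost
  surely no visit is the last one. The walk starts at \<open>0\<close>, so there is a first visit to continue from.
\<close>

lemma (in sequence_space) walk_zero_infinitely_often:
  fixes h :: "'a \<Rightarrow> 'b::{second_countable_topology, real_normed_vector}"
  assumes [measurable]: "h \<in> borel_measurable M"
    and div: "\<not> summable (\<lambda>n. measure S {\<omega> \<in> space S. walk h \<omega> n = 0})"
  shows "AE \<omega> in S. \<exists>\<^sub>\<infinity>n. walk h \<omega> n = 0"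
proof -
  define p where "p n = measure S {\<omega> \<in> space S. walk h \<omega> n = 0}" for n
  define q where "q K = measure S {\<omega> \<in> space S. \<forall>k\<in>{1..K}. walk h \<omega> k \<noteq> 0}" for K
  define L where "L n K = {\<omega> \<in> space S. walk h \<omega> n = 0 \<and> (\<forall>k\<in>{1..K}. walk h \<omega> (n + k) \<noteq> 0)}" for n K
  have [measurable]: "L n K \<in> sets S" for n K
    unfolding L_def by measurable
  have L: "measure S (L n K) = p n * q K" for n K
    unfolding p_def q_def
  proof (rule prob_S_comb_seq[where n = n])
    fix \<omega> \<omega>' assume "\<omega> \<in> space S" "\<omega>' \<in> space S"
    moreover from this have "comb_seq n \<omega> \<omega>' \<in> space S"
      by (auto simp: space_PiM PiE_iff comb_seq_def)
    ultimately show "comb_seq n \<omega> \<omega>' \<in> L n K \<longleftrightarrow> \<omega> \<in> {\<omega> \<in> space S. walk h \<omega> n = 0} \<and>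
        \<omega>' \<in> {\<omega> \<in> space S. \<forall>k\<in>{1..K}. walk h \<omega> k \<noteq> 0}"
      unfolding L_def by (auto simp: walk_comb_seq)
  qed measurable
  have sum_le: "(\<Sum>n<N. p n) * q N \<le> 1" for N
  proof -
    have "disjoint_family_on (\<lambda>n. L n N) {..<N}"
      unfolding disjoint_family_on_def
    proof (intro ballI impI)
      fix m n assume mn: "m \<in> {..<N}" "n \<in> {..<N}" "m \<noteq> n"
      have "L m N \<inter> L n N = {}" if "m < n" "n < N" for m n
      proof -
        have "n = m + (n - m)" "n - m \<in> {1..N}" using that by auto
        then show ?thesis unfolding L_def by fastforce
      qed
      from this[of m n] this[of n m] mn show "L m N \<inter> L n N = {}"
        by (cases m n rule: linorder_cases) auto
    qed
    then have "(\<Sum>n<N. measure S (L n N)) = measure S (\<Union>n<N. L n N)"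
      by (intro finite_measure_finite_Union[symmetric]) auto
    also have "\<dots> \<le> 1" by simp
    finally show ?thesis by (simp add: L sum_distrib_right)
  qed
  have p_nonneg: "p n \<ge> 0" for n by (simp add: p_def)
  \<comment> \<open>Otherwise the partial sums of \<open>p\<close> would be bounded by \<open>1 / e\<close>.\<close>
  have q_small: "\<exists>N. q N \<le> e" if "e > 0" for e
  proof (rule ccontr)
    assume "\<nexists>N. q N \<le> e"
    then have *: "q N > e" for N by (meson not_le)
    have "(\<Sum>n<N. p n) \<le> 1 / e" for N
    proof -
      have "(\<Sum>n<N. p n) * e \<le> (\<Sum>n<N. p n) * q N"
        using * p_nonneg by (intro mult_left_mono sum_nonneg) (auto intro: less_imp_le)
      with sum_le[of N] that show ?thesis by (simp add: field_simps)
    qed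
    then have "summable p"
      using p_nonneg by (intro bounded_imp_summable[of _ "1 / e"])
        (auto simp: lessThan_Suc_atMost[symmetric] simp del: sum.lessThan_Suc)
    with div show False unfolding p_def by simp
  qed
  have "AE \<omega> in S. \<not> (walk h \<omega> n = 0 \<and> (\<forall>k\<ge>1. walk h \<omega> (n + k) \<noteq> 0))" for n
  proof (rule AE_I)
    let ?N = "\<Inter>K. L n K"
    show "{\<omega> \<in> space S. \<not> \<not> (walk h \<omega> n = 0 \<and> (\<forall>k\<ge>1. walk h \<omega> (n + k) \<noteq> 0))} \<subseteq> ?N"
      by (auto simp: L_def)
    show "?N \<in> sets S" by measurable
    have "measure S ?N \<le> e" if e: "e > 0" for e
    proof -
      obtain N where "q N \<le> e" using q_small[OF e] by blast
      have "measure S ?N \<le> measure S (L n N)"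
        by (intro finite_measure_mono) auto
      also have "\<dots> = p n * q N" by (rule L)
      also have "\<dots> \<le> 1 * q N"
        by (intro mult_right_mono) (auto simp: p_def q_def)
      finally show ?thesis using \<open>q N \<le> e\<close> by simp
    qed
    then have "measure S ?N = 0"
      by (metis dense_ge measure_nonneg order_antisym)
    then show "emeasure S ?N = 0"
      by (simp add: emeasure_eq_measure)
  qed
  then have "AE \<omega> in S. \<forall>n. \<not> (walk h \<omega> n = 0 \<and> (\<forall>k\<ge>1. walk h \<omega> (n + k) \<noteq> 0))"
    by (simp add: AE_all_countable)
  then show ?thesis
  proof eventually_elim
    case (elim \<omega>)
    have "\<exists>n\<ge>m. walk h \<omega> n = 0" for m
    proof (induction m)
      case 0
      show ?case by (rule exI[of _ 0]) simp
    next
      case (Suc m)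
      then obtain n where "n \<ge> m" "walk h \<omega> n = 0" by blast
      moreover from this elim obtain k where "k \<ge> 1" "walk h \<omega> (n + k) = 0" by blast
      ultimately show ?case by (intro exI[of _ "n + k"]) auto
    qed
    then show ?case by (auto simp: INFM_nat_le)
  qed
qed

section \<open>A strong law of large numbers with second moments\<close>

lemma (in sequence_space) integral_pair_fst_snd:
  fixes f :: "'a \<Rightarrow> 'b::{banach, second_countable_topology}"
    and g :: "(nat \<Rightarrow> 'a) \<Rightarrow> 'c::{banach, second_countable_topology}"
  shows "integrable M f \<Longrightarrow> integrable (M \<Otimes>\<^sub>M S) (\<lambda>p. f (fst p))"
    and "f \<in> borel_measurable M \<Longrightarrow> (\<integral>p. f (fst p) \<partial>(M \<Otimes>\<^sub>M S)) = (\<integral>s. f s \<partial>M)"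
    and "integrable S g \<Longrightarrow> integrable (M \<Otimes>\<^sub>M S) (\<lambda>p. g (snd p))"
    and "g \<in> borel_measurable S \<Longrightarrow> (\<integral>p. g (snd p) \<partial>(M \<Otimes>\<^sub>M S)) = (\<integral>\<omega>. g \<omega> \<partial>S)"
proof -
  interpret MS: pair_prob_space M S ..
  have 1: "distr (M \<Otimes>\<^sub>M S) M fst = M"
    by (simp add: P.distr_pair_fst P.emeasure_space_1)
  have 2: "distr (M \<Otimes>\<^sub>M S) S snd = S"
  proof (rule measure_eqI)
    fix A assume "A \<in> sets (distr (M \<Otimes>\<^sub>M S) S snd)"
    then have A: "A \<in> sets S" by simp
    have "snd -` A \<inter> space (M \<Otimes>\<^sub>M S) = space M \<times> A"
      using sets.sets_into_space[OF A] by (auto simp: space_pair_measure)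
    with A show "emeasure (distr (M \<Otimes>\<^sub>M S) S snd) A = emeasure S A"
      by (simp add: emeasure_distr P.emeasure_pair_measure_Times M.emeasure_space_1)
  qed simp
  show "integrable M f \<Longrightarrow> integrable (M \<Otimes>\<^sub>M S) (\<lambda>p. f (fst p))"
    using integrable_distr[of fst "M \<Otimes>\<^sub>M S" M f] 1 by simp
  show "f \<in> borel_measurable M \<Longrightarrow> (\<integral>p. f (fst p) \<partial>(M \<Otimes>\<^sub>M S)) = (\<integral>s. f s \<partial>M)"
    using integral_distr[of fst "M \<Otimes>\<^sub>M S" M f] 1 by simp
  show "integrable S g \<Longrightarrow> integrable (M \<Otimes>\<^sub>M S) (\<lambda>p. g (snd p))"
    using integrable_distr[of snd "M \<Otimes>\<^sub>M S" S g] 2 by simp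
  show "g \<in> borel_measurable S \<Longrightarrow> (\<integral>p. g (snd p) \<partial>(M \<Otimes>\<^sub>M S)) = (\<integral>\<omega>. g \<omega> \<partial>S)"
    using integral_distr[of snd "M \<Otimes>\<^sub>M S" S g] 2 by simp
qed

text \<open>
  Variances of independent centred summands add up: the cross term of the new step with the earlier
  walk factorizes, and one factor is the vanishing mean.
\<close>

lemma (in sequence_space) walk_second_moment:
  fixes Z :: "'a \<Rightarrow> real"
  assumes [measurable]: "Z \<in> borel_measurable M"
    and sq: "integrable M (\<lambda>s. (Z s)\<^sup>2)" and mean: "(\<integral>s. Z s \<partial>M) = 0"
  shows "integrable S (\<lambda>\<omega>. (walk Z \<omega> n)\<^sup>2) \<and> (\<integral>\<omega>. (walk Z \<omega> n)\<^sup>2 \<partial>S) = n * (\<integral>s. (Z s)\<^sup>2 \<partial>M)"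
proof (induction n)
  case 0
  then show ?case by simp
next
  case (Suc n)
  interpret MS: pair_prob_space M S ..
  let ?f = "\<lambda>p. (Z (fst p))\<^sup>2" and ?g = "\<lambda>p. (walk Z (snd p) n)\<^sup>2"
  let ?c = "\<lambda>p. Z (fst p) * walk Z (snd p) n"
  have f: "integrable (M \<Otimes>\<^sub>M S) ?f" and g: "integrable (M \<Otimes>\<^sub>M S) ?g"
    using sq Suc.IH by (auto intro: integral_pair_fst_snd)
  have c: "integrable (M \<Otimes>\<^sub>M S) ?c"
  proof (rule Bochner_Integration.integrable_bound[OF Bochner_Integration.integrable_add[OF f g]])
    have "\<bar>a * b\<bar> \<le> \<bar>a\<^sup>2 + b\<^sup>2\<bar>" for a b :: real
    proof -
      have "2 * (\<bar>a\<bar> * \<bar>b\<bar>) \<le> a\<^sup>2 + b\<^sup>2"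
        using sum_squares_bound[of "\<bar>a\<bar>" "\<bar>b\<bar>"] by (simp add: mult.assoc)
      moreover have "0 \<le> \<bar>a\<bar> * \<bar>b\<bar>" by simp
      ultimately show ?thesis unfolding abs_mult by linarith
    qed
    then show "AE p in M \<Otimes>\<^sub>M S. norm (?c p) \<le> norm (?f p + ?g p)"
      by simp
  qed measurable
  have c0: "(\<integral>p. ?c p \<partial>(M \<Otimes>\<^sub>M S)) = 0"
  proof -
    have "(\<integral>p. ?c p \<partial>(M \<Otimes>\<^sub>M S)) = (\<integral>s. (\<integral>\<omega>. Z s * walk Z \<omega> n \<partial>S) \<partial>M)"
      using MS.integral_fst'[OF c] by simp
    also have "\<dots> = 0" by (simp add: mean)
    finally show ?thesis .
  qed
  have eq: "(walk Z (case_nat (fst p) (snd p)) (Suc n))\<^sup>2 = ?f p + (2 * ?c p + ?g p)" for p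
    by (simp add: walk_Suc_case_nat power2_sum)
  have "integrable S (\<lambda>\<omega>. (walk Z \<omega> (Suc n))\<^sup>2)"
    by (subst integral_case_nat(2)) (use f g c in \<open>auto simp: eq\<close>)
  moreover have "(\<integral>\<omega>. (walk Z \<omega> (Suc n))\<^sup>2 \<partial>S) = (\<integral>p. ?f p \<partial>(M \<Otimes>\<^sub>M S)) + (\<integral>p. ?g p \<partial>(M \<Otimes>\<^sub>M S))"
    by (subst integral_case_nat(1)) (use f g c c0 in \<open>auto simp: eq\<close>)
  moreover have "(\<integral>p. ?f p \<partial>(M \<Otimes>\<^sub>M S)) = (\<integral>s. (Z s)\<^sup>2 \<partial>M)"
    by (rule integral_pair_fst_snd(2)) measurable
  moreover have "(\<integral>p. ?g p \<partial>(M \<Otimes>\<^sub>M S)) = (\<integral>\<omega>. (walk Z \<omega> n)\<^sup>2 \<partial>S)"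
    by (rule integral_pair_fst_snd(4)) measurable
  ultimately show ?case using Suc.IH by (simp add: algebra_simps)
qed

lemma (in sequence_space) sum_abs_second_moment:
  fixes Z :: "'a \<Rightarrow> real"
  assumes [measurable]: "Z \<in> borel_measurable M"
    and sq: "integrable M (\<lambda>s. (Z s)\<^sup>2)" and I: "finite I"
  shows "integrable S (\<lambda>\<omega>. (\<Sum>i\<in>I. \<bar>Z (\<omega> i)\<bar>)\<^sup>2)"
    and "(\<integral>\<omega>. (\<Sum>i\<in>I. \<bar>Z (\<omega> i)\<bar>)\<^sup>2 \<partial>S) \<le> (real (card I))\<^sup>2 * (\<integral>s. (Z s)\<^sup>2 \<partial>M)"
proof -
  have comp: "integrable S (\<lambda>\<omega>. (Z (\<omega> i))\<^sup>2)" "(\<integral>\<omega>. (Z (\<omega> i))\<^sup>2 \<partial>S) = (\<integral>s. (Z s)\<^sup>2 \<partial>M)" for i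
    using integrable_distr[of "\<lambda>\<omega>. \<omega> i" S M "\<lambda>s. (Z s)\<^sup>2"] integral_distr[of "\<lambda>\<omega>. \<omega> i" S M "\<lambda>s. (Z s)\<^sup>2"]
      PiM_component[of i] sq by simp_all
  let ?u = "\<lambda>\<omega>. (\<Sum>i\<in>I. \<bar>Z (\<omega> i)\<bar>)\<^sup>2" and ?v = "\<lambda>\<omega>. real (card I) * (\<Sum>i\<in>I. (Z (\<omega> i))\<^sup>2)"
  have le: "?u \<omega> \<le> ?v \<omega>" for \<omega>
    using sum_squared_le_sum_of_squares[of "\<lambda>i. \<bar>Z (\<omega> i)\<bar>" I] by (simp add: mult.commute)
  have v: "integrable S ?v"
    using comp by auto
  show u: "integrable S ?u"
    by (rule Bochner_Integration.integrable_bound[OF v])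
       (use le in \<open>auto simp: abs_of_nonneg sum_nonneg\<close>)
  have "(\<integral>\<omega>. ?u \<omega> \<partial>S) \<le> (\<integral>\<omega>. ?v \<omega> \<partial>S)"
    by (intro integral_mono u v le)
  also have "\<dots> = (real (card I))\<^sup>2 * (\<integral>s. (Z s)\<^sup>2 \<partial>M)"
    by (subst integral_mult_right_zero, subst Bochner_Integration.integral_sum)
       (simp_all add: comp, simp add: power2_eq_square)
  finally show "(\<integral>\<omega>. ?u \<omega> \<partial>S) \<le> (real (card I))\<^sup>2 * (\<integral>s. (Z s)\<^sup>2 \<partial>M)" .
qed

lemma (in finite_measure) second_moment_Markov:
  fixes u :: "'a \<Rightarrow> real"
  assumes [measurable]: "u \<in> borel_measurable M" and "integrable M (\<lambda>x. (u x)\<^sup>2)" "c > 0"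
  shows "measure M {x \<in> space M. c \<le> \<bar>u x\<bar>} \<le> (\<integral>x. (u x)\<^sup>2 \<partial>M) / c\<^sup>2"
proof -
  have "c \<le> \<bar>a\<bar> \<longleftrightarrow> c\<^sup>2 \<le> a\<^sup>2" for a
    using abs_le_square_iff[of c a] \<open>c > 0\<close> by simp
  then show ?thesis
    using integral_Markov_inequality_measure[of M "\<lambda>x. (u x)\<^sup>2" "{}" "c\<^sup>2"] assms by simp
qed

text \<open>
  The strong law for centred steps. By Chebyshev's inequality the deviations at the times
  \<open>(Suc n)\<^sup>2\<close> have probabilities of order \<open>1 / n\<^sup>2\<close>. Between two consecutive squares there
  are only about \<open>2 * n\<close> steps; the second moment of the sum of their absolute values is of order
  \<open>n\<^sup>2\<close> as well, compared with the square \<open>n\<^sup>4\<close> of the allowed deviation. Both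
  families are summable, and the Borel-Cantelli lemma applies.
\<close>

lemma (in sequence_space) walk_sublinear:
  fixes Z :: "'a \<Rightarrow> real" and e :: real
  assumes [measurable]: "Z \<in> borel_measurable M"
    and sq: "integrable M (\<lambda>s. (Z s)\<^sup>2)" and mean: "(\<integral>s. Z s \<partial>M) = 0" and e: "e > 0"
  shows "AE \<omega> in S. \<forall>\<^sub>F n in sequentially. \<bar>walk Z \<omega> n\<bar> \<le> e * n"
proof -
  define v where "v = (\<integral>s. (Z s)\<^sup>2 \<partial>M)"
  have v: "v \<ge> 0" by (simp add: v_def)
  define I where "I n = {(Suc n)\<^sup>2..<(Suc (Suc n))\<^sup>2}" for n :: nat
  \<comment> \<open>Half of the admissible deviation, once for the walk at a square and once for the following block.\<close>
  define c where "c n = e / 2 * (real (Suc n))\<^sup>2" for n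
  have c: "c n > 0" for n using e by (simp add: c_def)
  define A where "A n = {\<omega> \<in> space S. c n \<le> \<bar>walk Z \<omega> ((Suc n)\<^sup>2)\<bar>}" for n
  define B where "B n = {\<omega> \<in> space S. c n \<le> \<bar>\<Sum>i\<in>I n. \<bar>Z (\<omega> i)\<bar>\<bar>}" for n
  have [measurable]: "A n \<in> sets S" "B n \<in> sets S" for n
    unfolding A_def B_def by measurable
  have A: "measure S (A n) \<le> (4 * v / e\<^sup>2) * inverse ((real (Suc n))\<^sup>2)" for n
  proof -
    have "measure S (A n) \<le> (\<integral>\<omega>. (walk Z \<omega> ((Suc n)\<^sup>2))\<^sup>2 \<partial>S) / (c n)\<^sup>2"
      unfolding A_def using walk_second_moment[OF assms(1) sq mean] c
      by (intro P.second_moment_Markov) auto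
    also have "\<dots> = real ((Suc n)\<^sup>2) * v / (c n)\<^sup>2"
      using walk_second_moment[OF assms(1) sq mean, of "(Suc n)\<^sup>2"] by (simp add: v_def del: of_nat_Suc)
    also have "\<dots> = (4 * v / e\<^sup>2) * inverse ((real (Suc n))\<^sup>2)"
      unfolding of_nat_power c_def using e by (simp add: field_simps power2_eq_square del: of_nat_Suc)
    finally show ?thesis .
  qed
  have B: "measure S (B n) \<le> (36 * v / e\<^sup>2) * inverse ((real (Suc n))\<^sup>2)" for n
  proof -
    have card: "real (card (I n)) \<le> 3 * real (Suc n)"
      by (simp add: I_def power2_eq_square)
    have "measure S (B n) \<le> (\<integral>\<omega>. (\<Sum>i\<in>I n. \<bar>Z (\<omega> i)\<bar>)\<^sup>2 \<partial>S) / (c n)\<^sup>2"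
      unfolding B_def using c sum_abs_second_moment(1)[OF assms(1) sq]
      by (intro P.second_moment_Markov) (auto simp: I_def)
    also have "\<dots> \<le> ((real (card (I n)))\<^sup>2 * v) / (c n)\<^sup>2"
      unfolding v_def by (intro divide_right_mono sum_abs_second_moment sq) (auto simp: I_def)
    also have "\<dots> \<le> ((3 * real (Suc n))\<^sup>2 * v) / (c n)\<^sup>2"
      using card v by (intro divide_right_mono mult_right_mono power_mono) auto
    also have "\<dots> = (36 * v / e\<^sup>2) * inverse ((real (Suc n))\<^sup>2)"
      using e by (simp add: c_def field_simps power2_eq_square del: of_nat_Suc)
    finally show ?thesis .
  qed
  have s: "summable (\<lambda>n. inverse ((real (Suc n))\<^sup>2))"
    using inverse_power_summable[of 2, where 'a = real] by (subst summable_Suc_iff) simp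
  have sA: "summable (\<lambda>n. measure S (A n))"
    by (rule summable_comparison_test'[OF summable_mult[OF s]], subst real_norm_def)
       (use A in \<open>simp only: abs_of_nonneg measure_nonneg\<close>)
  have sB: "summable (\<lambda>n. measure S (B n))"
    by (rule summable_comparison_test'[OF summable_mult[OF s]], subst real_norm_def)
       (use B in \<open>simp only: abs_of_nonneg measure_nonneg\<close>)
  have "AE \<omega> in S. \<forall>\<^sub>F n in sequentially. \<omega> \<in> space S - A n"
    by (rule borel_cantelli_AE1[OF _ _ sA]) (auto simp: less_top[symmetric])
  moreover have "AE \<omega> in S. \<forall>\<^sub>F n in sequentially. \<omega> \<in> space S - B n"
    by (rule borel_cantelli_AE1[OF _ _ sB]) (auto simp: less_top[symmetric])
  ultimately show ?thesis
  proof eventually_elim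
    case (elim \<omega>)
    then have "\<forall>\<^sub>F n in sequentially. \<omega> \<in> space S - A n \<and> \<omega> \<in> space S - B n"
      by (rule eventually_conj)
    then obtain N where N: "\<And>n. n \<ge> N \<Longrightarrow> \<omega> \<in> space S - A n \<and> \<omega> \<in> space S - B n"
      by (auto simp: eventually_sequentially)
    have "\<bar>walk Z \<omega> m\<bar> \<le> e * m" if m: "m \<ge> (Suc N)\<^sup>2" for m
    proof -
      have "Suc N \<le> floor_sqrt m" using m by (simp add: le_floor_sqrt_iff)
      then obtain n where n: "floor_sqrt m = Suc n" "n \<ge> N" by (cases "floor_sqrt m") auto
      have lo: "(Suc n)\<^sup>2 \<le> m" using floor_sqrt_power2_le[of m] n by simp
      have hi: "m < (Suc (Suc n))\<^sup>2" using Suc_floor_sqrt_power2_gt[of m] n by simp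
      have "walk Z \<omega> m = walk Z \<omega> ((Suc n)\<^sup>2) + (\<Sum>i\<in>{(Suc n)\<^sup>2..<m}. Z (\<omega> i))"
        unfolding walk_def lessThan_atLeast0 using lo by (simp add: sum.atLeastLessThan_concat)
      also have "\<bar>\<dots>\<bar> \<le> \<bar>walk Z \<omega> ((Suc n)\<^sup>2)\<bar> + (\<Sum>i\<in>{(Suc n)\<^sup>2..<m}. \<bar>Z (\<omega> i)\<bar>)"
        by (rule order_trans[OF abs_triangle_ineq add_left_mono[OF sum_abs]])
      also have "(\<Sum>i\<in>{(Suc n)\<^sup>2..<m}. \<bar>Z (\<omega> i)\<bar>) \<le> (\<Sum>i\<in>I n. \<bar>Z (\<omega> i)\<bar>)"
        unfolding I_def using hi by (intro sum_mono2) auto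
      also have "\<bar>walk Z \<omega> ((Suc n)\<^sup>2)\<bar> + (\<Sum>i\<in>I n. \<bar>Z (\<omega> i)\<bar>) \<le> c n + c n"
        using N[OF n(2)] by (auto simp: A_def B_def)
      also have "\<dots> = e * real ((Suc n)\<^sup>2)"
        by (simp add: c_def)
      also have "\<dots> \<le> e * m"
        using lo e by (intro mult_left_mono of_nat_mono) auto
      finally show ?thesis by simp
    qed
    then show ?case by (auto simp: eventually_sequentially)
  qed
qed

section \<open>Fourier inversion on the two-dimensional torus\<close>

lemma norm_iexp_mult_le: "norm (iexp a * iexp b) \<le> 1"
  by (simp add: norm_mult)

text \<open>
  Lebesgue measure on one period of the integer characters. It is a density on the whole line, so that
  its measurable sets are the Borel sets.
\<close>

definition period :: "real measure" where
  "period = density lborel (\<lambda>s. ennreal (indicator {-pi..pi} s))"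

lemma space_period [simp]: "space period = UNIV"
  by (simp add: period_def)

lemma sets_period [simp, measurable_cong]: "sets period = sets borel"
  by (simp add: period_def)

lemma emeasure_period: "A \<in> sets borel \<Longrightarrow> emeasure period A = emeasure lborel ({-pi..pi} \<inter> A)"
  unfolding period_def
  by (subst emeasure_density)
     (auto simp: ennreal_indicator indicator_inter_arith[symmetric] simp flip: nn_integral_indicator)

interpretation period: finite_measure period
  by (rule finite_measureI) (simp add: emeasure_period)

interpretation torus: pair_sigma_finite period period ..

interpretation torus: finite_measure "period \<Otimes>\<^sub>M period"
proof (rule finite_measureI)
  have "emeasure (period \<Otimes>\<^sub>M period) (space period \<times> space period) =
      emeasure period (space period) * emeasure period (space period)"
    by (rule period.emeasure_pair_measure_Times) auto
  then show "emeasure (period \<Otimes>\<^sub>M period) (space (period \<Otimes>\<^sub>M period)) \<noteq> \<infinity>"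
    by (simp add: space_pair_measure ennreal_mult_eq_top_iff period.emeasure_eq_measure)
qed

text \<open>
  Orthogonality of the integer characters; this is what singles out the event that a walk is at \<open>0\<close>.
\<close>

lemma integral_period_iexp:
  "(\<integral>s. iexp (s * of_int a) \<partial>period) = (if a = 0 then complex_of_real (2 * pi) else 0)"
proof -
  have "(\<integral>s. iexp (s * of_int a) \<partial>period) = (\<integral>s. indicator {-pi..pi} s *\<^sub>R iexp (s * of_int a) \<partial>lborel)"
  proof -
    have "indicat_real {-pi..pi} \<in> borel_measurable lborel" by measurable
    moreover have "(\<lambda>s. iexp (s * of_int a)) \<in> borel_measurable lborel" by measurable
    ultimately show ?thesis unfolding period_def by (intro integral_density AE_I2) simp_all
  qed
  also have "\<dots> = (if a = 0 then complex_of_real (2 * pi) else 0)"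
  proof (cases "a = 0")
    case True
    then show ?thesis by (simp add: scaleR_conv_of_real)
  next
    case False
    let ?F = "\<lambda>s. iexp (s * of_int a) / (\<i> * of_int a)"
    have "(\<integral>s. indicator {-pi..pi} s *\<^sub>R iexp (s * of_int a) \<partial>lborel) = ?F pi - ?F (- pi)"
    proof (rule integral_FTC_atLeastAtMost)
      fix x
      show "(?F has_vector_derivative iexp (x * of_int a)) (at x within {-pi..pi})"
        using False by (auto intro!: derivative_eq_intros has_vector_derivative_real_field simp: field_simps)
    qed (auto intro!: continuous_intros)
    also have "?F pi = ?F (- pi)"
    proof -
      have "iexp (pi * of_int a) = iexp (- pi * of_int a) * exp (2 * of_int a * of_real pi * \<i>)"
        by (subst exp_add[symmetric]) (simp add: algebra_simps)
      also have "exp (2 * of_int a * of_real pi * \<i>) = 1"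
        by (simp add: exp_eq_1)
      finally show ?thesis by simp
    qed
    finally show ?thesis using False by simp
  qed
  finally show ?thesis .
qed

lemma (in finite_measure) integrable_bounded:
  fixes f :: "'a \<Rightarrow> 'b::{banach, second_countable_topology}"
  assumes "f \<in> borel_measurable M" "\<And>x. x \<in> space M \<Longrightarrow> norm (f x) \<le> B"
  shows "integrable M f"
  using assms by (intro integrable_const_bound[of _ B]) auto

lemma (in sequence_space) integral_iexp_walk:
  assumes [measurable]: "h \<in> borel_measurable M"
  shows "(\<integral>\<omega>. iexp (walk h \<omega> n) \<partial>S) = (\<integral>x. iexp (h x) \<partial>M) ^ n"
proof (induction n)
  case 0
  then show ?case by (simp add: P.prob_space)
next
  case (Suc n)
  interpret MS: pair_prob_space M S ..
  have eq: "iexp (walk h (case_nat (fst p) (snd p)) (Suc n)) = iexp (h (fst p)) * iexp (walk h (snd p) n)" for p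
    unfolding walk_Suc_case_nat of_real_add distrib_left exp_add ..
  have int: "integrable (M \<Otimes>\<^sub>M S) (\<lambda>p. iexp (h (fst p)) * iexp (walk h (snd p) n))"
  proof (rule MS.integrable_const_bound[where B = 1])
    show "AE p in M \<Otimes>\<^sub>M S. norm (iexp (h (fst p)) * iexp (walk h (snd p) n)) \<le> 1"
      by (intro AE_I2 norm_iexp_mult_le)
  qed measurable
  have "(\<integral>\<omega>. iexp (walk h \<omega> (Suc n)) \<partial>S) =
      (\<integral>p. iexp (h (fst p)) * iexp (walk h (snd p) n) \<partial>(M \<Otimes>\<^sub>M S))"
  proof -
    have "(\<lambda>\<omega>. iexp (walk h \<omega> (Suc n))) \<in> borel_measurable S" by measurable
    then show ?thesis by (simp only: integral_case_nat(1) eq)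
  qed
  also have "\<dots> = (\<integral>x. (\<integral>\<omega>. iexp (h x) * iexp (walk h \<omega> n) \<partial>S) \<partial>M)"
    using MS.integral_fst'[OF int] by simp
  also have "\<dots> = (\<integral>x. iexp (h x) \<partial>M) ^ Suc n"
    by (simp add: Suc)
  finally show ?case .
qed

definition (in prob_space) joint_char :: "('a \<Rightarrow> int) \<Rightarrow> ('a \<Rightarrow> int) \<Rightarrow> real \<times> real \<Rightarrow> complex" where
  "joint_char f g q = (\<integral>x. iexp (fst q * of_int (f x) + snd q * of_int (g x)) \<partial>M)"

lemma (in prob_space) measurable_joint_char [measurable]:
  assumes [measurable]: "f \<in> measurable M (count_space UNIV)" "g \<in> measurable M (count_space UNIV)"
  shows "joint_char f g \<in> borel_measurable (period \<Otimes>\<^sub>M period)"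
  unfolding joint_char_def by measurable

lemma (in prob_space) norm_joint_char_le: "norm (joint_char f g q) \<le> 1"
proof -
  have "norm (joint_char f g q) \<le> (\<integral>x. norm (iexp (fst q * of_int (f x) + snd q * of_int (g x))) \<partial>M)"
    unfolding joint_char_def by (rule integral_norm_bound)
  then show ?thesis by (simp add: prob_space)
qed

lemma integral_torus_iexp:
  "(\<integral>q. iexp (fst q * of_int a) * iexp (snd q * of_int b) \<partial>(period \<Otimes>\<^sub>M period)) =
    (if a = 0 \<and> b = 0 then complex_of_real (4 * pi\<^sup>2) else 0)"
proof -
  have int: "integrable (period \<Otimes>\<^sub>M period) (\<lambda>q. iexp (fst q * of_int a) * iexp (snd q * of_int b))"
    by (rule torus.integrable_bounded[OF _ norm_iexp_mult_le]) measurable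
  have "(\<integral>q. iexp (fst q * of_int a) * iexp (snd q * of_int b) \<partial>(period \<Otimes>\<^sub>M period)) =
      (\<integral>s. (\<integral>t. iexp (s * of_int a) * iexp (t * of_int b) \<partial>period) \<partial>period)"
    using torus.integral_fst'[OF int] by simp
  also have "\<dots> = (\<integral>s. iexp (s * of_int a) \<partial>period) * (\<integral>t. iexp (t * of_int b) \<partial>period)"
    by simp
  also have "\<dots> = (if a = 0 \<and> b = 0 then complex_of_real (4 * pi\<^sup>2) else 0)"
    unfolding integral_period_iexp by (simp add: power2_eq_square)
  finally show ?thesis .
qed

lemma walk_of_int: "walk (\<lambda>x. of_int (f x)) \<omega> n = of_int (walk f \<omega> n)"
  by (simp add: walk_def)

text \<open>
  The \<open>n\<close>-th power of the joint characteristic function of one step is that of the walk after \<open>n\<close>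
  steps. Integrating over the torus under the expectation leaves, by orthogonality, only those
  sequences for which both coordinates are \<open>0\<close> at time \<open>n\<close>.
\<close>

lemma (in sequence_space) integral_joint_char_power:
  assumes [measurable]: "f \<in> measurable M (count_space UNIV)" "g \<in> measurable M (count_space UNIV)"
  shows "(\<integral>q. M.joint_char f g q ^ n \<partial>(period \<Otimes>\<^sub>M period)) =
    complex_of_real (4 * pi\<^sup>2 * measure S {\<omega> \<in> space S. walk f \<omega> n = 0 \<and> walk g \<omega> n = 0})"
proof -
  interpret QS: pair_sigma_finite "period \<Otimes>\<^sub>M period" S ..
  interpret QSf: finite_measure "(period \<Otimes>\<^sub>M period) \<Otimes>\<^sub>M S"
  proof (rule finite_measureI)
    have "emeasure ((period \<Otimes>\<^sub>M period) \<Otimes>\<^sub>M S) (space (period \<Otimes>\<^sub>M period) \<times> space S) =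
        emeasure (period \<Otimes>\<^sub>M period) (space (period \<Otimes>\<^sub>M period)) * emeasure S (space S)"
      by (rule P.emeasure_pair_measure_Times[OF sets.top sets.top])
    then show "emeasure ((period \<Otimes>\<^sub>M period) \<Otimes>\<^sub>M S) (space ((period \<Otimes>\<^sub>M period) \<Otimes>\<^sub>M S)) \<noteq> \<infinity>"
      by (simp add: space_pair_measure[of "period \<Otimes>\<^sub>M period"] P.emeasure_space_1 torus.emeasure_eq_measure)
  qed
  define F where "F \<omega> = walk (\<lambda>x. real_of_int (f x)) \<omega> n" for \<omega>
  define G where "G \<omega> = walk (\<lambda>x. real_of_int (g x)) \<omega> n" for \<omega>
  have [measurable]: "F \<in> borel_measurable S" "G \<in> borel_measurable S"
    unfolding F_def G_def by measurable
  let ?Z = "{\<omega> \<in> space S. walk f \<omega> n = 0 \<and> walk g \<omega> n = 0}"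
  have "?Z = {\<omega> \<in> space S. F \<omega> = 0 \<and> G \<omega> = 0}"
    by (simp add: walk_of_int F_def G_def)
  also have "\<dots> \<in> sets S" by measurable
  finally have [measurable]: "?Z \<in> sets S" .
  have "(\<integral>q. M.joint_char f g q ^ n \<partial>(period \<Otimes>\<^sub>M period)) =
      (\<integral>q. (\<integral>\<omega>. iexp (fst q * F \<omega>) * iexp (snd q * G \<omega>) \<partial>S) \<partial>(period \<Otimes>\<^sub>M period))"
  proof (rule Bochner_Integration.integral_cong[OF refl])
    fix q :: "real \<times> real"
    have "M.joint_char f g q ^ n = (\<integral>\<omega>. iexp (walk (\<lambda>x. fst q * of_int (f x) + snd q * of_int (g x)) \<omega> n) \<partial>S)"
      unfolding M.joint_char_def by (rule integral_iexp_walk[symmetric]) measurable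
    also have "\<dots> = (\<integral>\<omega>. iexp (fst q * F \<omega>) * iexp (snd q * G \<omega>) \<partial>S)"
      by (simp add: F_def G_def walk_def sum.distrib sum_distrib_left distrib_left exp_add)
    finally show "M.joint_char f g q ^ n = \<dots>" .
  qed
  also have "\<dots> = (\<integral>\<omega>. (\<integral>q. iexp (fst q * F \<omega>) * iexp (snd q * G \<omega>) \<partial>(period \<Otimes>\<^sub>M period)) \<partial>S)"
    by (rule QS.Fubini_integral[symmetric])
       (unfold case_prod_beta, rule QSf.integrable_bounded[OF _ norm_iexp_mult_le], measurable)
  also have "\<dots> = (\<integral>\<omega>. indicator ?Z \<omega> *\<^sub>R complex_of_real (4 * pi\<^sup>2) \<partial>S)"
    unfolding F_def G_def walk_of_int integral_torus_iexp
    by (rule Bochner_Integration.integral_cong[OF refl]) auto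
  also have "\<dots> = complex_of_real (4 * pi\<^sup>2 * measure S ?Z)"
    by (subst integral_scaleR_left) (auto simp: scaleR_conv_of_real less_top[symmetric])
  finally show ?thesis .
qed

text \<open>
  Summing Fourier inversion against \<open>r ^ n\<close> turns the powers into a geometric series. The factor \<open>r\<close>
  keeps the integrand bounded: without it there is a singularity at least at the origin, and in general
  also along the frequencies at which the characteristic function has value \<open>1\<close>.
\<close>

lemma (in sequence_space) integral_resolvent:
  fixes r :: real
  assumes [measurable]: "f \<in> measurable M (count_space UNIV)" "g \<in> measurable M (count_space UNIV)"
    and r: "0 \<le> r" "r < 1"
    and sum: "summable (\<lambda>n. measure S {\<omega> \<in> space S. walk f \<omega> n = 0 \<and> walk g \<omega> n = 0})"
  shows "(\<integral>q. Re (1 / (1 - r * M.joint_char f g q)) \<partial>(period \<Otimes>\<^sub>M period)) \<le>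
      4 * pi\<^sup>2 * (\<Sum>n. measure S {\<omega> \<in> space S. walk f \<omega> n = 0 \<and> walk g \<omega> n = 0})"
    and "integrable (period \<Otimes>\<^sub>M period) (\<lambda>q. Re (1 / (1 - r * M.joint_char f g q)))"
proof -
  define p where "p n = measure S {\<omega> \<in> space S. walk f \<omega> n = 0 \<and> walk g \<omega> n = 0}" for n
  let ?Q = "period \<Otimes>\<^sub>M period" and ?\<phi> = "M.joint_char f g"
  let ?u = "\<lambda>n q. (complex_of_real r * ?\<phi> q) ^ n"
  have bound: "norm (complex_of_real r * ?\<phi> q) \<le> r" for q
    using mult_left_mono[OF M.norm_joint_char_le r(1)] r by (simp add: norm_mult)
  then have bound_n: "norm (?u n q) \<le> r ^ n" for n q
    unfolding norm_power by (intro power_mono) auto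
  have int: "integrable ?Q (?u n)" for n
    by (rule torus.integrable_bounded[OF _ bound_n]) measurable
  have geo: "summable (\<lambda>n. r ^ n)" using r by simp
  have AE: "AE q in ?Q. summable (\<lambda>n. norm (?u n q))"
    using bound_n by (intro AE_I2 summable_comparison_test'[OF geo]) auto
  have summ: "summable (\<lambda>n. \<integral>q. norm (?u n q) \<partial>?Q)"
  proof (rule summable_comparison_test'[OF summable_mult[OF geo]])
    fix n
    have "(\<integral>q. norm (?u n q) \<partial>?Q) \<le> (\<integral>q. r ^ n \<partial>?Q)"
      by (intro integral_mono integrable_norm int bound_n) auto
    then show "norm (\<integral>q. norm (?u n q) \<partial>?Q) \<le> measure ?Q (space ?Q) * r ^ n"
      by simp
  qed
  have eq: "(\<Sum>n. ?u n q) = 1 / (1 - r * ?\<phi> q)" for q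
    using bound[of q] r by (intro suminf_geometric) auto
  have i: "integrable ?Q (\<lambda>q. 1 / (1 - r * ?\<phi> q))"
    using integrable_suminf[OF int AE summ] by (simp only: eq)
  show "integrable ?Q (\<lambda>q. Re (1 / (1 - r * ?\<phi> q)))"
    by (rule integrable_Re[OF i])
  have "(\<integral>q. ?u n q \<partial>?Q) = complex_of_real (4 * pi\<^sup>2 * (r ^ n * p n))" for n
    using integral_joint_char_power[OF assms(1,2), of n]
    by (simp add: power_mult_distrib p_def)
  then have "(\<lambda>n. complex_of_real (4 * pi\<^sup>2 * (r ^ n * p n))) sums (\<integral>q. 1 / (1 - r * ?\<phi> q) \<partial>?Q)"
    using sums_integral[OF int AE summ] by (simp only: eq)
  then have "(\<lambda>n. 4 * pi\<^sup>2 * (r ^ n * p n)) sums Re (\<integral>q. 1 / (1 - r * ?\<phi> q) \<partial>?Q)"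
    by (auto dest: sums_Re)
  also have "Re (\<integral>q. 1 / (1 - r * ?\<phi> q) \<partial>?Q) = (\<integral>q. Re (1 / (1 - r * ?\<phi> q)) \<partial>?Q)"
    by (rule integral_Re[OF i, symmetric])
  finally have s: "(\<lambda>n. 4 * pi\<^sup>2 * (r ^ n * p n)) sums (\<integral>q. Re (1 / (1 - r * ?\<phi> q)) \<partial>?Q)" .
  have "(\<integral>q. Re (1 / (1 - r * ?\<phi> q)) \<partial>?Q) \<le> (\<Sum>n. 4 * pi\<^sup>2 * p n)"
  proof (rule sums_le[OF _ s])
    show "(\<lambda>n. 4 * pi\<^sup>2 * p n) sums (\<Sum>n. 4 * pi\<^sup>2 * p n)"
      using sum by (intro summable_sums summable_mult) (simp add: p_def)
    show "4 * pi\<^sup>2 * (r ^ n * p n) \<le> 4 * pi\<^sup>2 * p n" for n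
      using r by (intro mult_left_mono mult_left_le_one_le) (auto simp: p_def power_le_one)
  qed
  also have "(\<Sum>n. 4 * pi\<^sup>2 * p n) = 4 * pi\<^sup>2 * (\<Sum>n. p n)"
    using sum by (intro suminf_mult) (simp add: p_def)
  finally show "(\<integral>q. Re (1 / (1 - r * ?\<phi> q)) \<partial>?Q) \<le>
      4 * pi\<^sup>2 * (\<Sum>n. measure S {\<omega> \<in> space S. walk f \<omega> n = 0 \<and> walk g \<omega> n = 0})"
    by (simp add: p_def)
qed

section \<open>Recurrence of centred integer walks in the plane\<close>

text \<open>
  A centred step has no linear term in the expansion of its characteristic function at the origin, so
  the deviation from \<open>1\<close> is quadratic.
\<close>

lemma (in prob_space) norm_one_minus_joint_char_le:
  assumes [measurable]: "f \<in> measurable M (count_space UNIV)" "g \<in> measurable M (count_space UNIV)"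
    and f: "integrable M (\<lambda>x. (real_of_int (f x))\<^sup>2)" and g: "integrable M (\<lambda>x. (real_of_int (g x))\<^sup>2)"
    and f0: "(\<integral>x. real_of_int (f x) \<partial>M) = 0" and g0: "(\<integral>x. real_of_int (g x) \<partial>M) = 0"
  shows "norm (1 - joint_char f g q) \<le>
    ((fst q)\<^sup>2 + (snd q)\<^sup>2) / 2 * (\<integral>x. (real_of_int (f x))\<^sup>2 + (real_of_int (g x))\<^sup>2 \<partial>M)"
proof -
  define \<theta> where "\<theta> x = fst q * of_int (f x) + snd q * of_int (g x)" for x
  have [measurable]: "\<theta> \<in> borel_measurable M" unfolding \<theta>_def by measurable
  have "integrable M (\<lambda>x. real_of_int (f x))" "integrable M (\<lambda>x. real_of_int (g x))"
    by (rule square_integrable_imp_integrable[OF _ f] square_integrable_imp_integrable[OF _ g], measurable)+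
  then have \<theta>: "integrable M \<theta>" "(\<integral>x. \<theta> x \<partial>M) = 0"
    unfolding \<theta>_def using f0 g0 by auto
  have i: "integrable M (\<lambda>x. iexp (\<theta> x))"
    by (rule integrable_bounded[where B = 1]) auto
  have i\<theta>: "integrable M (\<lambda>x. \<i> * complex_of_real (\<theta> x))"
    using \<theta>(1) by (intro integrable_mult_right integrable_of_real)
  have "(\<integral>x. \<i> * complex_of_real (\<theta> x) \<partial>M) = 0"
    using \<theta>(2) by simp
  then have "joint_char f g q - 1 = (\<integral>x. iexp (\<theta> x) - 1 - \<i> * complex_of_real (\<theta> x) \<partial>M)"
    using i i\<theta> by (simp add: joint_char_def \<theta>_def prob_space)
  also have "norm \<dots> \<le> (\<integral>x. norm (iexp (\<theta> x) - 1 - \<i> * complex_of_real (\<theta> x)) \<partial>M)"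
    by (rule integral_norm_bound)
  also have "\<dots> \<le> (\<integral>x. ((fst q)\<^sup>2 + (snd q)\<^sup>2) / 2 * ((real_of_int (f x))\<^sup>2 + (real_of_int (g x))\<^sup>2) \<partial>M)"
  proof (rule integral_mono)
    fix x
    have "norm (iexp (\<theta> x) - 1 - \<i> * complex_of_real (\<theta> x)) \<le> (\<theta> x)\<^sup>2 / 2"
      using iexp_approx1[of "\<theta> x" 1] by (simp add: algebra_simps numeral_2_eq_2)
    also have "(\<theta> x)\<^sup>2 \<le> ((fst q)\<^sup>2 + (snd q)\<^sup>2) * ((real_of_int (f x))\<^sup>2 + (real_of_int (g x))\<^sup>2)"
    proof -
      have "(a * c + b * d)\<^sup>2 \<le> (a\<^sup>2 + b\<^sup>2) * (c\<^sup>2 + d\<^sup>2)" for a b c d :: real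
        using zero_le_power2[of "a * d - b * c"] by (simp add: power2_eq_square algebra_simps)
      then show ?thesis unfolding \<theta>_def .
    qed
    finally show "norm (iexp (\<theta> x) - 1 - \<i> * complex_of_real (\<theta> x)) \<le>
        ((fst q)\<^sup>2 + (snd q)\<^sup>2) / 2 * ((real_of_int (f x))\<^sup>2 + (real_of_int (g x))\<^sup>2)"
      by simp
  qed (use i i\<theta> f g in auto)
  also have "\<dots> = ((fst q)\<^sup>2 + (snd q)\<^sup>2) / 2 * (\<integral>x. (real_of_int (f x))\<^sup>2 + (real_of_int (g x))\<^sup>2 \<partial>M)"
    by simp
  finally show ?thesis by (simp add: norm_minus_commute)
qed

text \<open>
  The integrand \<open>1 - cos\<close> is nonnegative, so a single atom of the step already gives a lower bound.
  This bound is useful also for steps concentrated on a line, where no bound by the full square of the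
  frequency can hold.
\<close>

lemma (in prob_space) Re_one_minus_joint_char_ge:
  assumes [measurable]: "f \<in> measurable M (count_space UNIV)" "g \<in> measurable M (count_space UNIV)"
  shows "prob {x \<in> space M. f x = a \<and> g x = b} * (1 - cos (fst q * of_int a + snd q * of_int b))
    \<le> Re (1 - joint_char f g q)"
proof -
  let ?A = "{x \<in> space M. f x = a \<and> g x = b}"
  define \<theta> where "\<theta> x = fst q * of_int (f x) + snd q * of_int (g x)" for x
  have [measurable]: "\<theta> \<in> borel_measurable M" unfolding \<theta>_def by measurable
  have i: "integrable M (\<lambda>x. iexp (\<theta> x))"
    by (rule integrable_bounded[where B = 1]) auto
  have c: "integrable M (\<lambda>x. cos (\<theta> x))"
    by (rule integrable_bounded[where B = 1]) auto
  have "prob ?A * (1 - cos (fst q * of_int a + snd q * of_int b)) =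
      (\<integral>x. indicator ?A x * (1 - cos (fst q * of_int a + snd q * of_int b)) \<partial>M)"
    by simp
  also have "\<dots> \<le> (\<integral>x. 1 - cos (\<theta> x) \<partial>M)"
  proof (rule integral_mono)
    show "integrable M (\<lambda>x. indicator ?A x * (1 - cos (fst q * of_int a + snd q * of_int b)))"
      by (intro integrable_mult_left integrable_real_indicator) (measurable, simp add: less_top[symmetric])
  qed (use c in \<open>auto simp: \<theta>_def indicator_def\<close>)
  also have "\<dots> = Re (1 - (\<integral>x. iexp (\<theta> x) \<partial>M))"
    using c integral_Re[OF i] by (simp add: prob_space Re_exp)
  finally show ?thesis unfolding joint_char_def \<theta>_def .
qed

text \<open>
  The Taylor expansion gives \<open>1 / 2\<close> as coefficient of \<open>x\<^sup>2\<close>, and the remainder costs at most \<open>1 / 6\<close>.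
\<close>

lemma one_minus_cos_ge: "\<bar>x\<bar> \<le> 1 \<Longrightarrow> x\<^sup>2 / 3 \<le> 1 - cos x" for x :: real
proof -
  assume x: "\<bar>x\<bar> \<le> 1"
  have "\<bar>Re (iexp x - (\<Sum>k\<le>2. (\<i> * x)^k / fact k))\<bar> \<le> \<bar>x\<bar>^3 / 6"
    using iexp_approx1[of x 2] by (intro order_trans[OF abs_Re_le_cmod]) (simp add: eval_nat_numeral)
  moreover have "Re (iexp x - (\<Sum>k\<le>2. (\<i> * x)^k / fact k)) = cos x - 1 + x\<^sup>2 / 2"
    by (simp add: eval_nat_numeral Re_exp)
  moreover have "\<bar>x\<bar>^3 \<le> x\<^sup>2"
    using mult_left_mono[OF x, of "x\<^sup>2"] by (simp add: power3_eq_cube power2_eq_square abs_mult_self_eq)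
  ultimately show ?thesis by linarith
qed

lemma Re_inverse_eq: "Re (1 / w) = Re w / (norm w)\<^sup>2"
  by (simp add: Re_divide cmod_power2)

lemma Re_resolvent_nonneg:
  assumes "norm \<phi> \<le> 1" "0 \<le> r" "r < 1"
  shows "0 \<le> Re (1 / (1 - complex_of_real r * \<phi>))"
proof -
  have "Re (complex_of_real r * \<phi>) \<le> norm (complex_of_real r * \<phi>)" by (rule complex_Re_le_cmod)
  also have "\<dots> \<le> 1" using assms by (simp add: norm_mult mult_le_one)
  finally have "0 \<le> Re (1 - complex_of_real r * \<phi>)" by simp
  then show ?thesis unfolding Re_inverse_eq by (intro divide_nonneg_nonneg zero_le_power2)
qed

text \<open>
  At a frequency of size \<open>h\<close> the deviation from \<open>1\<close> is of order \<open>h\<^sup>2\<close> with real part of the same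
  order, and then so are the denominator and its real part; hence the reciprocal has real part of order
  \<open>1 / h\<^sup>2\<close>. The condition \<open>1 - r \<le> h\<^sup>2\<close> keeps the contribution of the damping within
  the same order.
\<close>

lemma Re_resolvent_ge:
  assumes h: "h > 0" and c: "c > 0" "C \<ge> 0"
    and re: "c * h\<^sup>2 \<le> Re (1 - \<phi>)" and norm: "norm (1 - \<phi>) \<le> C * h\<^sup>2"
    and r: "1 / 2 \<le> r" "r < 1" "1 - r \<le> h\<^sup>2"
  shows "c / (2 * (1 + C)\<^sup>2) / h\<^sup>2 \<le> Re (1 / (1 - complex_of_real r * \<phi>))"
proof -
  let ?w = "1 - complex_of_real r * \<phi>"
  have w: "?w = complex_of_real (1 - r) + complex_of_real r * (1 - \<phi>)"
    by (simp add: algebra_simps)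
  have "1 / 2 * (c * h\<^sup>2) \<le> r * Re (1 - \<phi>)"
    using r re c by (intro mult_mono) auto
  also have "\<dots> \<le> Re ?w" unfolding w using r by simp
  finally have 1: "c * h\<^sup>2 / 2 \<le> Re ?w" by simp
  then have pos: "0 < Re ?w" using c h by (smt (verit) divide_pos_pos mult_pos_pos zero_less_power)
  have "norm ?w \<le> (1 - r) + r * norm (1 - \<phi>)"
    unfolding w using r by (intro order_trans[OF norm_triangle_ineq]) (simp add: norm_mult del: of_real_diff)
  also have "\<dots> \<le> h\<^sup>2 + 1 * (C * h\<^sup>2)"
    using r norm by (intro add_mono mult_mono) auto
  finally have "norm ?w \<le> (1 + C) * h\<^sup>2" by (simp add: algebra_simps)
  then have 2: "(norm ?w)\<^sup>2 \<le> ((1 + C) * h\<^sup>2)\<^sup>2" by (intro power_mono) auto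
  have "?w \<noteq> 0" using pos by (metis less_irrefl zero_complex.sel(1))
  then have w0: "0 < (norm ?w)\<^sup>2" by (simp del: right_minus_eq)
  have "c / (2 * D\<^sup>2) / h\<^sup>2 = (c * h\<^sup>2 / 2) / (D * h\<^sup>2)\<^sup>2" for D
    using h by (simp add: power2_eq_square)
  then have "c / (2 * (1 + C)\<^sup>2) / h\<^sup>2 = (c * h\<^sup>2 / 2) / ((1 + C) * h\<^sup>2)\<^sup>2" .
  also have "\<dots> \<le> Re ?w / (norm ?w)\<^sup>2"
    using 1 2 w0 pos by (intro frac_le) auto
  also have "\<dots> = Re (1 / ?w)"
    by (rule Re_inverse_eq[symmetric])
  finally show ?thesis .
qed

text \<open>
  For \<open>\<sigma> = 1\<close> and \<open>\<sigma> = -1\<close> these are the intervals of dyadic size \<open>h\<close> on the positive and on the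
  negative half-line.
\<close>

definition strip :: "real \<Rightarrow> real \<Rightarrow> real set" where
  "strip \<sigma> h = {s. h \<le> \<sigma> * s \<and> \<sigma> * s < 2 * h}"

lemma strip_measurable [measurable]: "strip \<sigma> h \<in> sets borel"
  unfolding strip_def by measurable

lemma measure_strip_times_strip:
  assumes "\<bar>\<sigma>\<bar> = 1" "\<bar>\<tau>\<bar> = 1" "0 < h" "h \<le> 1"
  shows "measure (period \<Otimes>\<^sub>M period) (strip \<sigma> h \<times> strip \<tau> h) = h\<^sup>2"
proof -
  have 1: "emeasure period (strip \<sigma> h) = ennreal h" if \<sigma>: "\<bar>\<sigma>\<bar> = 1" for \<sigma> :: real
  proof -
    \<comment> \<open>So the strips lie inside one period.\<close>
    have pi: "2 * h \<le> pi" using pi_ge_two assms(4) by linarith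
    consider "\<sigma> = 1" | "\<sigma> = -1" using \<sigma> by linarith
    then show ?thesis
    proof cases
      case 1
      then have "{-pi..pi} \<inter> strip \<sigma> h = {h..<2 * h}"
        using pi assms by (auto simp: strip_def)
      then show ?thesis using assms by (simp add: emeasure_period)
    next
      case 2
      then have "{-pi..pi} \<inter> strip \<sigma> h = {- 2 * h<..- h}"
        using pi assms by (auto simp: strip_def)
      then show ?thesis using assms by (simp add: emeasure_period)
    qed
  qed
  have "emeasure (period \<Otimes>\<^sub>M period) (strip \<sigma> h \<times> strip \<tau> h) = emeasure period (strip \<sigma> h) * emeasure period (strip \<tau> h)"
    by (rule period.emeasure_pair_measure_Times) auto
  also have "\<dots> = ennreal (h\<^sup>2)"
    using assms by (simp add: 1 power2_eq_square ennreal_mult)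
  finally show ?thesis using assms by (simp add: measure_def)
qed

text \<open>
  Choosing the signs of the frequencies to match those of \<open>a\<close> and \<open>b\<close> excludes cancellation in the
  phase \<open>s * a + t * b\<close>, so that it is comparable to \<open>h\<close> on the whole square.
\<close>

lemma strip_phase:
  fixes a b :: int
  defines "\<sigma> \<equiv> if a < 0 then - 1 else (1::real)" and "\<tau> \<equiv> if b < 0 then - 1 else (1::real)"
  assumes s: "s \<in> strip \<sigma> h" and t: "t \<in> strip \<tau> h" and h: "0 < h" and ab: "a \<noteq> 0 \<or> b \<noteq> 0"
  shows "h \<le> \<bar>s * of_int a + t * of_int b\<bar>"
    and "\<bar>s * of_int a + t * of_int b\<bar> \<le> 2 * h * (\<bar>of_int a\<bar> + \<bar>of_int b\<bar>)"
    and "s\<^sup>2 + t\<^sup>2 \<le> 8 * h\<^sup>2"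
proof -
  have sa: "s * of_int a = (\<sigma> * s) * \<bar>of_int a\<bar>" and tb: "t * of_int b = (\<tau> * t) * \<bar>of_int b\<bar>"
    by (auto simp: \<sigma>_def \<tau>_def)
  have s': "h \<le> \<sigma> * s" "\<sigma> * s \<le> 2 * h" and t': "h \<le> \<tau> * t" "\<tau> * t \<le> 2 * h"
    using s t by (auto simp: strip_def)
  have A: "h * \<bar>of_int a\<bar> \<le> s * of_int a" "s * of_int a \<le> 2 * h * \<bar>of_int a\<bar>"
    unfolding sa using s' by (intro mult_right_mono; simp)+
  have B: "h * \<bar>of_int b\<bar> \<le> t * of_int b" "t * of_int b \<le> 2 * h * \<bar>of_int b\<bar>"
    unfolding tb using t' by (intro mult_right_mono; simp)+
  have "h * 1 \<le> h * (\<bar>of_int a\<bar> + \<bar>of_int b\<bar>)"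
    using ab h by (intro mult_left_mono) linarith+
  then have "h * 1 \<le> s * of_int a + t * of_int b"
    using A B by (simp add: distrib_left)
  then show "h \<le> \<bar>s * of_int a + t * of_int b\<bar>" by simp
  have "0 \<le> s * of_int a + t * of_int b"
    using A B h by (smt (verit) mult_nonneg_nonneg)
  then show "\<bar>s * of_int a + t * of_int b\<bar> \<le> 2 * h * (\<bar>of_int a\<bar> + \<bar>of_int b\<bar>)"
    using A B by (simp add: distrib_left)
  have "(\<sigma> * s)\<^sup>2 = s\<^sup>2" "(\<tau> * t)\<^sup>2 = t\<^sup>2" by (auto simp: \<sigma>_def \<tau>_def)
  moreover have "(\<sigma> * s)\<^sup>2 \<le> (2 * h)\<^sup>2" "(\<tau> * t)\<^sup>2 \<le> (2 * h)\<^sup>2"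
    using s' t' h by (intro power_mono; simp)+
  moreover have "(2 * h)\<^sup>2 = 4 * h\<^sup>2" by simp
  ultimately show "s\<^sup>2 + t\<^sup>2 \<le> 8 * h\<^sup>2" by linarith
qed

lemma (in sequence_space) return_event:
  fixes f g :: "'a \<Rightarrow> int"
  assumes [measurable]: "f \<in> measurable M (count_space UNIV)" "g \<in> measurable M (count_space UNIV)"
  shows "{\<omega> \<in> space S. walk f \<omega> n = 0 \<and> walk g \<omega> n = 0} \<in> sets S"
proof -
  have "{\<omega> \<in> space S. walk f \<omega> n = 0 \<and> walk g \<omega> n = 0} =
      {\<omega> \<in> space S. walk (\<lambda>x. real_of_int (f x)) \<omega> n = 0 \<and> walk (\<lambda>x. real_of_int (g x)) \<omega> n = 0}"
    by (simp add: walk_of_int)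
  also have "\<dots> \<in> sets S" by measurable
  finally show ?thesis .
qed

text \<open>
  If the step vanishes almost surely, all return probabilities are \<open>1\<close>. Otherwise it has an atom
  \<open>(a, b) \<noteq> (0, 0)\<close>. On a square of side \<open>h k\<close> with the signs of this atom the integrand of
  \<open>integral_resolvent\<close> is at least \<open>\<kappa> / (h k)\<^sup>2\<close>, so each of the squares contributes at
  least \<open>\<kappa>\<close>, whatever its size. The squares for \<open>h k\<close> proportional to \<open>1 / 2 ^ k\<close> are disjoint, and
  letting \<open>r\<close> approach \<open>1\<close> makes arbitrarily many of them count. It is here that the dimension of the
  walk matters: the area of the square exactly compensates the size of the integrand.
\<close>

lemma (in sequence_space) not_summable_return_probabilities:
  fixes f g :: "'a \<Rightarrow> int"
  assumes fg [measurable]: "f \<in> measurable M (count_space UNIV)" "g \<in> measurable M (count_space UNIV)"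
    and f2: "integrable M (\<lambda>x. (real_of_int (f x))\<^sup>2)" and g2: "integrable M (\<lambda>x. (real_of_int (g x))\<^sup>2)"
    and f0: "(\<integral>x. real_of_int (f x) \<partial>M) = 0" and g0: "(\<integral>x. real_of_int (g x) \<partial>M) = 0"
  shows "\<not> summable (\<lambda>n. measure S {\<omega> \<in> space S. walk f \<omega> n = 0 \<and> walk g \<omega> n = 0})" (is "\<not> summable ?p")
proof
  assume sum: "summable ?p"
  let ?Q = "period \<Otimes>\<^sub>M period" and ?\<phi> = "M.joint_char f g"
  have "\<exists>a b. (a \<noteq> 0 \<or> b \<noteq> 0) \<and> M.prob {x \<in> space M. f x = a \<and> g x = b} > 0"
  proof (rule ccontr)
    assume "\<not> ?thesis"
    then have "M.prob {x \<in> space M. f x = a \<and> g x = b} = 0" if "a \<noteq> 0 \<or> b \<noteq> 0" for a b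
      using that by (metis measure_nonneg order_antisym not_less)
    then have "AE x in M. (a \<noteq> 0 \<or> b \<noteq> 0) \<longrightarrow> \<not> (f x = a \<and> g x = b)" for a b
      by (cases "a \<noteq> 0 \<or> b \<noteq> 0")
         (auto intro!: AE_I[where N = "{x \<in> space M. f x = a \<and> g x = b}"] simp: M.emeasure_eq_measure)
    then have "AE x in M. \<forall>a b. (a \<noteq> 0 \<or> b \<noteq> 0) \<longrightarrow> \<not> (f x = a \<and> g x = b)"
      by (intro AE_all_countable[THEN iffD2] allI)
    then have "AE x in M. f x = 0 \<and> g x = 0"
      by eventually_elim blast
    then have "AE \<omega> in S. f (\<omega> i) = 0 \<and> g (\<omega> i) = 0" for i
      using AE_PiM_component[of UNIV "\<lambda>_. M" i "\<lambda>x. f x = 0 \<and> g x = 0"] M.prob_space_axioms by simp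
    then have "AE \<omega> in S. \<forall>i. f (\<omega> i) = 0 \<and> g (\<omega> i) = 0"
      by (intro AE_all_countable[THEN iffD2] allI)
    then have AE: "AE \<omega> in S. walk f \<omega> n = 0 \<and> walk g \<omega> n = 0" for n
      by eventually_elim (simp add: walk_def)
    have "?p n = 1" for n
      using AE by (simp only: P.prob_Collect_eq_1[OF return_event[OF fg]])
    with summable_LIMSEQ_zero[OF sum] show False by (simp add: LIMSEQ_const_iff)
  qed
  then obtain a b where ab: "a \<noteq> 0 \<or> b \<noteq> 0" and pab: "M.prob {x \<in> space M. f x = a \<and> g x = b} > 0"
    by blast
  define \<sigma> where "\<sigma> = (if a < 0 then - 1 else (1::real))"
  define \<tau> where "\<tau> = (if b < 0 then - 1 else (1::real))"
  have \<sigma>\<tau>: "\<bar>\<sigma>\<bar> = 1" "\<bar>\<tau>\<bar> = 1" by (auto simp: \<sigma>_def \<tau>_def)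
  define L where "L = \<bar>real_of_int a\<bar> + \<bar>real_of_int b\<bar>"
  have L: "L \<ge> 1" using ab unfolding L_def by linarith
  \<comment> \<open>With this normalization the phase at the atom is at most \<open>1\<close>, as needed for \<open>one_minus_cos_ge\<close>.\<close>
  define h where "h k = 1 / (2 * L * 2 ^ k)" for k :: nat
  have h: "0 < h k" "2 * h k * L \<le> 1" "h k \<le> 1 / 2" for k
  proof -
    have "1 * 1 \<le> L * 2 ^ k" using L by (intro mult_mono) auto
    then show "h k \<le> 1 / 2" unfolding h_def by (simp add: field_simps)
  qed (use L in \<open>auto simp: h_def field_simps\<close>)
  have h_mono: "h j \<le> h k" if "k \<le> j" for j k
    unfolding h_def using L that by (intro divide_left_mono mult_left_mono power_increasing) auto
  have h_half: "2 * h j \<le> h k" if "k < j" for j k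
    using h_mono[of "Suc k" j] that by (simp add: h_def)
  define box where "box k = strip \<sigma> (h k) \<times> strip \<tau> (h k)" for k
  have [measurable]: "box k \<in> sets ?Q" for k unfolding box_def by measurable
  have box: "measure ?Q (box k) = (h k)\<^sup>2" for k
    unfolding box_def using h(1,3)[of k] \<sigma>\<tau> by (intro measure_strip_times_strip) auto
  have disj: "q \<notin> box j" if "q \<in> box k" "k < j" for q k j
    using h_half[OF that(2)] that(1) by (auto simp: box_def strip_def)
  define c where "c = M.prob {x \<in> space M. f x = a \<and> g x = b} / 3"
  define C where "C = 4 * (\<integral>x. (real_of_int (f x))\<^sup>2 + (real_of_int (g x))\<^sup>2 \<partial>M)"
  have c: "c > 0" using pab by (simp add: c_def)
  have C: "C \<ge> 0" by (simp add: C_def)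
  define \<kappa> where "\<kappa> = c / (2 * (1 + C)\<^sup>2)"
  have \<kappa>: "\<kappa> > 0" using c C by (simp add: \<kappa>_def)
  have lower: "\<kappa> / (h k)\<^sup>2 \<le> Re (1 / (1 - complex_of_real r * ?\<phi> q))"
    if q: "q \<in> box k" and r: "1 / 2 \<le> r" "r < 1" "1 - r \<le> (h k)\<^sup>2" for q k r
    unfolding \<kappa>_def
  proof (rule Re_resolvent_ge[OF h(1) c C _ _ r])
    obtain s t where st: "q = (s, t)" "s \<in> strip \<sigma> (h k)" "t \<in> strip \<tau> (h k)"
      using q by (auto simp: box_def)
    let ?z = "s * of_int a + t * of_int b"
    note phase = strip_phase[OF st(2,3)[unfolded \<sigma>_def \<tau>_def] h(1) ab]
    have "\<bar>?z\<bar> \<le> 1"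
      using phase(2) h(2)[of k] unfolding L_def by linarith
    then have "?z\<^sup>2 / 3 \<le> 1 - cos ?z" by (rule one_minus_cos_ge)
    moreover have "(h k)\<^sup>2 \<le> ?z\<^sup>2"
      using phase(1) h(1)[of k] by (metis abs_le_square_iff abs_of_pos)
    ultimately have "(h k)\<^sup>2 / 3 \<le> 1 - cos ?z" by linarith
    then have "M.prob {x \<in> space M. f x = a \<and> g x = b} * ((h k)\<^sup>2 / 3) \<le>
        M.prob {x \<in> space M. f x = a \<and> g x = b} * (1 - cos ?z)"
      by (intro mult_left_mono) auto
    also have "\<dots> \<le> Re (1 - ?\<phi> q)"
      using M.Re_one_minus_joint_char_ge[OF fg, of a b q] by (simp add: st(1))
    finally show "c * (h k)\<^sup>2 \<le> Re (1 - ?\<phi> q)" by (simp add: c_def)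
    have "norm (1 - ?\<phi> q) \<le> (s\<^sup>2 + t\<^sup>2) / 2 * (C / 4)"
      using M.norm_one_minus_joint_char_le[OF fg f2 g2 f0 g0, of q] by (simp add: st(1) C_def)
    also have "\<dots> \<le> (8 * (h k)\<^sup>2) / 2 * (C / 4)"
      using phase(3) C by (intro mult_right_mono divide_right_mono) auto
    finally show "norm (1 - ?\<phi> q) \<le> C * (h k)\<^sup>2" by (simp add: mult.commute)
  qed
  have "real (Suc K) * \<kappa> \<le> 4 * pi\<^sup>2 * (\<Sum>n. ?p n)" for K
  proof -
    \<comment> \<open>The smallest of the squares determines how close to \<open>1\<close> the damping has to be.\<close>
    define r where "r = 1 - (h K)\<^sup>2"
    have "(h K)\<^sup>2 \<le> (1 / 2)\<^sup>2" using h[of K] by (intro power_mono) auto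
    then have r: "1 / 2 \<le> r" "r < 1" using h(1)[of K] by (auto simp: r_def power2_eq_square)
    have rk: "1 - r \<le> (h k)\<^sup>2" if "k \<le> K" for k
      using power_mono[OF h_mono[OF that], of 2] h(1)[of K] by (simp add: r_def)
    let ?R = "\<lambda>q. Re (1 / (1 - complex_of_real r * ?\<phi> q))"
    have pointwise: "(\<Sum>k\<le>K. \<kappa> / (h k)\<^sup>2 * indicator (box k) q) \<le> ?R q" for q
    proof (cases "\<exists>k\<le>K. q \<in> box k")
      case True
      then obtain k where k: "k \<le> K" "q \<in> box k" by blast
      have "(\<Sum>j\<le>K. \<kappa> / (h j)\<^sup>2 * indicator (box j) q) = (\<Sum>j\<in>{k}. \<kappa> / (h j)\<^sup>2 * indicator (box j) q)"
      proof (rule sum.mono_neutral_right)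
        show "\<forall>j\<in>{..K} - {k}. \<kappa> / (h j)\<^sup>2 * indicator (box j) q = 0"
        proof
          fix j assume "j \<in> {..K} - {k}"
          then have "q \<notin> box j" using disj[of q k j] disj[of q j k] k by (cases j k rule: linorder_cases) auto
          then show "\<kappa> / (h j)\<^sup>2 * indicator (box j) q = 0" by simp
        qed
      qed (use k in auto)
      also have "\<dots> \<le> ?R q" using lower[OF k(2) r rk[OF k(1)]] k by simp
      finally show ?thesis .
    next
      case False
      then have "(\<Sum>k\<le>K. \<kappa> / (h k)\<^sup>2 * indicator (box k) q) = 0" by (intro sum.neutral) auto
      then show ?thesis using Re_resolvent_nonneg[OF M.norm_joint_char_le, of r f g q] r by simp
    qed
    have int: "integrable ?Q (\<lambda>q. \<kappa> / (h k)\<^sup>2 * indicator (box k) q)" for k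
      by (intro integrable_mult_right integrable_real_indicator) (measurable, simp add: less_top[symmetric])
    have "real (Suc K) * \<kappa> = (\<Sum>k\<le>K. \<kappa> / (h k)\<^sup>2 * measure ?Q (box k))"
    proof -
      have "\<kappa> / (h k)\<^sup>2 * measure ?Q (box k) = \<kappa>" for k
        using h(1)[of k] by (simp add: box)
      then show ?thesis by simp
    qed
    also have "\<dots> = (\<integral>q. (\<Sum>k\<le>K. \<kappa> / (h k)\<^sup>2 * indicator (box k) q) \<partial>?Q)"
    proof (subst Bochner_Integration.integral_sum)
      show "(\<Sum>k\<le>K. \<kappa> / (h k)\<^sup>2 * measure ?Q (box k)) =
          (\<Sum>k\<le>K. \<integral>q. \<kappa> / (h k)\<^sup>2 * indicator (box k) q \<partial>?Q)"
        by (simp add: space_pair_measure)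
    qed (rule int)
    also have "\<dots> \<le> (\<integral>q. ?R q \<partial>?Q)"
      using pointwise integral_resolvent(2)[OF fg _ r(2) sum] r
      by (intro integral_mono Bochner_Integration.integrable_sum int) auto
    also have "\<dots> \<le> 4 * pi\<^sup>2 * (\<Sum>n. ?p n)"
      using integral_resolvent(1)[OF fg _ r(2) sum] r by simp
    finally show ?thesis .
  qed
  moreover obtain K where "4 * pi\<^sup>2 * (\<Sum>n. ?p n) < real K * \<kappa>"
    using reals_Archimedean3[OF \<kappa>] by blast
  moreover have "real K * \<kappa> \<le> real (Suc K) * \<kappa>" using \<kappa> by simp
  ultimately show False by (meson not_le order_less_le_trans)
qed

lemma (in sequence_space) integer_walk_returns_infinitely_often:
  fixes f g :: "'a \<Rightarrow> int"
  assumes fg [measurable]: "f \<in> measurable M (count_space UNIV)" "g \<in> measurable M (count_space UNIV)"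
    and "integrable M (\<lambda>x. (real_of_int (f x))\<^sup>2)" "integrable M (\<lambda>x. (real_of_int (g x))\<^sup>2)"
    and "(\<integral>x. real_of_int (f x) \<partial>M) = 0" "(\<integral>x. real_of_int (g x) \<partial>M) = 0"
  shows "AE \<omega> in S. \<exists>\<^sub>\<infinity>n. walk f \<omega> n = 0 \<and> walk g \<omega> n = 0"
proof -
  define h where "h x = (real_of_int (f x), real_of_int (g x))" for x
  have [measurable]: "h \<in> borel_measurable M" unfolding h_def by measurable
  have "walk h \<omega> n = (walk (\<lambda>x. real_of_int (f x)) \<omega> n, walk (\<lambda>x. real_of_int (g x)) \<omega> n)" for \<omega> n
    unfolding walk_def h_def by (simp add: sum_prod)
  then have eq: "walk h \<omega> n = 0 \<longleftrightarrow> walk f \<omega> n = 0 \<and> walk g \<omega> n = 0" for \<omega> n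
    by (simp add: walk_of_int zero_prod_def)
  show ?thesis
    using walk_zero_infinitely_often[of h] not_summable_return_probabilities[OF assms]
    by (simp add: eq)
qed

section \<open>Distances in a locally finite connected graph\<close>

locale lf_connected_graph =
  fixes V :: "'v set" and E :: "'v rel"
  assumes graph: "graph V E" and locally_finite: "locally_finite_graph V E"
    and connected: "connected_graph V E"
begin

abbreviation d :: "'v \<Rightarrow> 'v \<Rightarrow> nat" where "d \<equiv> graph_dist E"

lemma relpow_dist: "u \<in> V \<Longrightarrow> v \<in> V \<Longrightarrow> (u, v) \<in> E ^^ d u v"
  using connected rtrancl_imp_relpow[of "(u, v)" E]
  unfolding connected_graph_def graph_dist_def by (metis LeastI_ex)

lemma dist_le: "(u, v) \<in> E ^^ n \<Longrightarrow> d u v \<le> n"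
  unfolding graph_dist_def by (rule Least_le)

lemma relpow_sym: "(u, v) \<in> E ^^ n \<Longrightarrow> (v, u) \<in> E ^^ n"
proof (induction n arbitrary: v)
  case (Suc n)
  then obtain w where "(u, w) \<in> E ^^ n" "(w, v) \<in> E" by auto
  with Suc.IH graph show ?case
    by (intro relpow_Suc_I2[of v w]) (auto simp: graph_def dest: symD)
qed simp

lemma dist_commute: "u \<in> V \<Longrightarrow> v \<in> V \<Longrightarrow> d u v = d v u"
  by (meson dist_le order_antisym relpow_dist relpow_sym)

lemma dist_triangle: "u \<in> V \<Longrightarrow> v \<in> V \<Longrightarrow> w \<in> V \<Longrightarrow> d u w \<le> d u v + d v w"
  using relpow_dist[of u v] relpow_dist[of v w] by (intro dist_le) (auto simp: relpow_add)

lemma finite_ball: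
  assumes "u \<in> V"
  shows "finite {v \<in> V. d u v \<le> n}"
proof -
  have sphere: "finite ((E ^^ k) `` {u}) \<and> (E ^^ k) `` {u} \<subseteq> V" for k
  proof (induction k)
    case (Suc k)
    have "(E ^^ Suc k) `` {u} = (\<Union>w\<in>(E ^^ k) `` {u}. E `` {w})" by auto
    with Suc show ?case
      using locally_finite graph by (auto simp: locally_finite_graph_def graph_def)
  qed (use assms in simp)
  have "{v \<in> V. d u v \<le> n} \<subseteq> (\<Union>k\<le>n. (E ^^ k) `` {u})"
    using relpow_dist[OF assms] by auto
  then show ?thesis by (rule finite_subset) (use sphere in auto)
qed

lemma countable_vertices: "countable V"
proof (cases "V = {}")
  case False
  then obtain u where u: "u \<in> V" by auto
  have "countable (\<Union>n. {v \<in> V. d u v \<le> n})"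
    by (rule countable_UN[OF countableI_type countable_finite[OF finite_ball[OF u]]])
  moreover have "(\<Union>n. {v \<in> V. d u v \<le> n}) = V" by auto
  ultimately show ?thesis by simp
qed simp

text \<open>
  This is the square of the reverse triangle inequality.
\<close>

lemma dist_square_diff_ge:
  assumes "u \<in> V" "v \<in> V" "s \<in> V"
  shows "(real (d v u))\<^sup>2 - 2 * real (d v u) * real (d v s) \<le> (real (d u s))\<^sup>2 - (real (d v s))\<^sup>2"
proof -
  have "d v u \<le> d v s + d u s" "d v s \<le> d v u + d u s"
    using dist_triangle[of v s u] dist_triangle[of v u s] dist_commute[of s u] assms by auto
  then have "\<bar>real (d v u) - real (d v s)\<bar> \<le> \<bar>real (d u s)\<bar>" by linarith
  then have "(real (d v u) - real (d v s))\<^sup>2 \<le> (real (d u s))\<^sup>2" by (rule abs_le_square_iff[THEN iffD1])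
  then show ?thesis by (simp add: power2_diff)
qed

text \<open>
  Factor the difference of squares: one factor is at most \<open>d v u\<close>, the other at most
  \<open>d v u + 2 * d v s\<close>.
\<close>

lemma dist_square_diff_square_le:
  assumes "u \<in> V" "v \<in> V" "s \<in> V"
  shows "((real (d u s))\<^sup>2 - (real (d v s))\<^sup>2)\<^sup>2 \<le> (real (d v u))\<^sup>2 * (8 * (real (d v s))\<^sup>2 + 2 * (real (d v u))\<^sup>2)"
proof -
  define R a b where "R = real (d v u)" and "a = real (d u s)" and "b = real (d v s)"
  have "a \<le> R + b" "b \<le> R + a"
    using dist_triangle[of u v s] dist_triangle[of v u s] dist_commute[of u v] assms by (auto simp: R_def a_def b_def)
  then have "\<bar>a - b\<bar> \<le> R" "\<bar>a + b\<bar> \<le> R + 2 * b" by (auto simp: a_def b_def)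
  then have "(a - b)\<^sup>2 \<le> R\<^sup>2" "(a + b)\<^sup>2 \<le> (R + 2 * b)\<^sup>2"
    by (metis abs_ge_zero abs_le_square_iff abs_of_nonneg order_trans)+
  moreover have "(R + 2 * b)\<^sup>2 \<le> 8 * b\<^sup>2 + 2 * R\<^sup>2"
    using zero_le_power2[of "R - 2 * b"] by (simp add: power2_eq_square algebra_simps)
  ultimately have "(a - b)\<^sup>2 * (a + b)\<^sup>2 \<le> R\<^sup>2 * (8 * b\<^sup>2 + 2 * R\<^sup>2)"
    by (intro mult_mono) auto
  then show ?thesis
    by (simp add: R_def a_def b_def power2_eq_square algebra_simps)
qed

end

section \<open>Weight functions as integrals and as sample averages\<close>

lemma infsum_eq_nn_integral:
  fixes f :: "'v \<Rightarrow> real"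
  assumes V: "countable V" and sets: "sets M = sets (count_space V)" and fin: "finite_measure M"
    and f: "\<And>s. s \<in> V \<Longrightarrow> f s \<ge> 0"
  shows "(\<Sum>\<^sub>\<infinity>s\<in>V. ennreal (f s * measure M {s})) = (\<integral>\<^sup>+s. ennreal (f s) \<partial>M)"
proof -
  interpret finite_measure M by fact
  have space: "space M = V" using sets_eq_imp_space_eq[OF sets] by simp
  have meas [measurable]: "g \<in> borel_measurable M" for g :: "'v \<Rightarrow> ennreal"
    unfolding measurable_cong_sets[OF sets refl] by simp
  have fin_sum: "(\<integral>\<^sup>+s. ennreal (f s) * indicator A s \<partial>M) = (\<Sum>s\<in>A. ennreal (f s * measure M {s}))"
    if "finite A" "A \<subseteq> V" for A
    using that f
    by (subst nn_integral_indicator_finite) (auto simp: sets emeasure_eq_measure ennreal_mult'' intro!: sum.cong)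
  have infsum: "(\<Sum>\<^sub>\<infinity>s\<in>V. ennreal (f s * measure M {s})) =
      (SUP A\<in>{A. finite A \<and> A \<subseteq> V}. \<Sum>s\<in>A. ennreal (f s * measure M {s}))"
    by (rule nonneg_infsum_complete) simp
  show ?thesis
  proof (rule antisym)
    show "(\<Sum>\<^sub>\<infinity>s\<in>V. ennreal (f s * measure M {s})) \<le> (\<integral>\<^sup>+s. ennreal (f s) \<partial>M)"
      unfolding infsum
    proof (rule SUP_least)
      fix A assume "A \<in> {A. finite A \<and> A \<subseteq> V}"
      then have "(\<Sum>s\<in>A. ennreal (f s * measure M {s})) = (\<integral>\<^sup>+s. ennreal (f s) * indicator A s \<partial>M)"
        by (simp add: fin_sum)
      also have "\<dots> \<le> (\<integral>\<^sup>+s. ennreal (f s) \<partial>M)"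
        by (intro nn_integral_mono) (auto simp: indicator_def)
      finally show "(\<Sum>s\<in>A. ennreal (f s * measure M {s})) \<le> (\<integral>\<^sup>+s. ennreal (f s) \<partial>M)" .
    qed
    show "(\<integral>\<^sup>+s. ennreal (f s) \<partial>M) \<le> (\<Sum>\<^sub>\<infinity>s\<in>V. ennreal (f s * measure M {s}))"
    proof (cases "V = {}")
      case True
      then show ?thesis using space by (simp add: nn_integral_empty)
    next
      case False
      \<comment> \<open>Exhaust \<open>V\<close> by an increasing sequence of finite sets, for monotone convergence.\<close>
      define A where "A n = from_nat_into V ` {..n}" for n
      have A: "finite (A n)" "A n \<subseteq> V" for n
        using from_nat_into[OF False] by (auto simp: A_def)
      have inc: "incseq A" by (auto simp: A_def incseq_def)
      have V_eq: "(\<Union>n. A n) = V"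
        using A(2) from_nat_into_surj[OF V] by (force simp: A_def)
      have "(\<integral>\<^sup>+s. ennreal (f s) \<partial>M) = (\<integral>\<^sup>+s. (SUP n. ennreal (f s) * indicator (A n) s) \<partial>M)"
      proof (rule nn_integral_cong)
        fix s assume "s \<in> space M"
        then obtain n where "s \<in> A n" using V_eq space by auto
        then show "ennreal (f s) = (SUP n. ennreal (f s) * indicator (A n) s)"
          by (intro antisym SUP_upper2[of n] SUP_least) (auto simp: indicator_def)
      qed
      also have "\<dots> = (SUP n. \<integral>\<^sup>+s. ennreal (f s) * indicator (A n) s \<partial>M)"
        by (rule nn_integral_monotone_convergence_SUP)
           (use inc in \<open>auto simp: incseq_def le_fun_def indicator_def\<close>)
      also have "\<dots> \<le> (\<Sum>\<^sub>\<infinity>s\<in>V. ennreal (f s * measure M {s}))"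
        unfolding infsum using A by (intro SUP_least) (auto simp: fin_sum intro!: SUP_upper)
      finally show ?thesis .
    qed
  qed
qed

lemma weight_sample_distribution:
  assumes x: "\<And>i. 1 \<le> i \<Longrightarrow> i \<le> n \<Longrightarrow> x i \<in> V"
  shows "weight V E (sample_distribution x n) v = ennreal ((\<Sum>i=1..n. (real (graph_dist E v (x i)))\<^sup>2) / n)"
proof -
  let ?f = "\<lambda>s. (real (graph_dist E v s))\<^sup>2" and ?F = "x ` {1..n}"
  have card: "{i. 1 \<le> i \<and> i \<le> n \<and> x i = s} = {i \<in> {1..n}. x i = s}" for s by auto
  have "weight V E (sample_distribution x n) v = (\<Sum>\<^sub>\<infinity>s\<in>?F. ennreal (?f s * sample_distribution x n s))"
    unfolding weight_def
  proof (rule infsum_cong_neutral)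
    fix s assume "s \<in> V - ?F"
    then have "{i \<in> {1..n}. x i = s} = {}" by auto
    then have "sample_distribution x n s = 0" unfolding sample_distribution_def card by simp
    then show "ennreal (?f s * sample_distribution x n s) = 0" by simp
  qed (use x in auto)
  also have "\<dots> = (\<Sum>s\<in>?F. ennreal (?f s * sample_distribution x n s))"
    by simp
  also have "\<dots> = ennreal (\<Sum>s\<in>?F. ?f s * sample_distribution x n s)"
    by (intro sum_ennreal) (simp add: sample_distribution_def)
  also have "(\<Sum>s\<in>?F. ?f s * sample_distribution x n s) = (\<Sum>s\<in>?F. \<Sum>i\<in>{i \<in> {1..n}. x i = s}. ?f (x i)) / n"
    unfolding sum_divide_distrib sample_distribution_def card by (intro sum.cong) auto
  also have "(\<Sum>s\<in>?F. \<Sum>i\<in>{i \<in> {1..n}. x i = s}. ?f (x i)) = (\<Sum>i=1..n. ?f (x i))"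
    by (rule sum.image_gen[symmetric]) simp
  finally show ?thesis .
qed

lemma sample_mean_set_cong:
  assumes "\<And>i. 1 \<le> i \<Longrightarrow> x i = y i"
  shows "sample_mean_set V E x n = sample_mean_set V E y n"
proof -
  have "{i. 1 \<le> i \<and> i \<le> n \<and> x i = u} = {i. 1 \<le> i \<and> i \<le> n \<and> y i = u}" for u
    using assms by auto
  then show ?thesis by (simp add: sample_mean_set_def sample_distribution_def[abs_def])
qed

section \<open>Mean-sets and sample mean-sets\<close>

text \<open>
  Almost sure statements about an i.i.d. sample depend only on its joint law. They are therefore proved
  on the product space over the law \<open>M\<close> of one random vertex, where shifting and prepending coordinates
  are explicit maps.
\<close>

locale vertex_sequence_space = lf_connected_graph V E + sequence_space M
  for V :: "'v set" and E :: "'v rel" and M :: "'v measure" +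
  assumes sets_M: "sets M = sets (count_space V)"
    and second_moment_finite: "v \<in> V \<Longrightarrow> (\<integral>\<^sup>+s. ennreal ((real (d v s))\<^sup>2) \<partial>M) < \<infinity>"
begin

text \<open>
  Squared distances are taken as integers, so that their differences are steps of an integer walk.
\<close>

definition sqdist :: "'v \<Rightarrow> 'v \<Rightarrow> int" where
  "sqdist v s = (int (d v s))\<^sup>2"

definition moment :: "'v \<Rightarrow> real" where
  "moment v = (\<integral>s. real_of_int (sqdist v s) \<partial>M)"

lemma space_M: "space M = V"
  using sets_eq_imp_space_eq[OF sets_M] by simp

lemma measurable_M [measurable]: "f \<in> borel_measurable M" "g \<in> measurable M (count_space UNIV)"
  unfolding measurable_cong_sets[OF sets_M refl] by simp_all

lemma integrable_sqdist: "v \<in> V \<Longrightarrow> integrable M (\<lambda>s. real_of_int (sqdist v s))"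
  using second_moment_finite[of v] by (intro integrableI_nonneg) (auto simp: sqdist_def)

lemma weight_eq_moment: "v \<in> V \<Longrightarrow> weight V E (\<lambda>s. measure M {s}) v = ennreal (moment v)"
  unfolding weight_def
  by (subst infsum_eq_nn_integral[OF countable_vertices sets_M M.finite_measure_axioms])
     (use nn_integral_eq_integral[OF integrable_sqdist] in \<open>auto simp: moment_def sqdist_def\<close>)

lemma moment_nonneg: "0 \<le> moment v"
  by (simp add: moment_def sqdist_def)

lemma minimizers_eq: "minimizers V E (\<lambda>s. measure M {s}) = {v \<in> V. \<forall>u\<in>V. moment v \<le> moment u}"
  unfolding minimizers_def using moment_nonneg by (auto simp: weight_eq_moment)

text \<open>
  The factor \<open>1 / n\<close> is irrelevant for minimization, which leaves a comparison of integer walks. The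
  coordinates of \<open>\<omega>\<close> are numbered from \<open>0\<close>, the sample from \<open>1\<close>.
\<close>

lemma sample_mean_set_eq:
  assumes "\<omega> \<in> space S" "n \<ge> 1"
  shows "sample_mean_set V E (\<lambda>i. \<omega> (i - 1)) n =
    {v \<in> V. \<forall>u\<in>V. walk (sqdist v) \<omega> n \<le> walk (sqdist u) \<omega> n}"
proof -
  have \<omega>: "\<omega> i \<in> V" for i using assms(1) by (auto simp: space_PiM space_M)
  have w: "weight V E (sample_distribution (\<lambda>i. \<omega> (i - 1)) n) v = ennreal (real_of_int (walk (sqdist v) \<omega> n) / n)" for v
  proof -
    have "(\<Sum>i=1..n. (real (d v (\<omega> (i - 1))))\<^sup>2) = real_of_int (walk (sqdist v) \<omega> n)"
      unfolding walk_def sqdist_def of_int_sum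
      by (rule sum.reindex_bij_witness[of _ Suc "\<lambda>i. i - 1"]) auto
    with \<omega> show ?thesis by (subst weight_sample_distribution) auto
  qed
  have nonneg: "0 \<le> walk (sqdist v) \<omega> n" for v by (auto simp: walk_def sqdist_def intro: sum_nonneg)
  show ?thesis
    unfolding sample_mean_set_def minimizers_def w using assms(2) nonneg
    by (auto simp: divide_le_cancel ennreal_le_iff)
qed

lemma walk_diff: "walk (\<lambda>s. f s - g s) \<omega> n = walk f \<omega> n - walk g \<omega> n" for f g :: "'v \<Rightarrow> 'b::ab_group_add"
  by (simp add: walk_def sum_subtractf)

text \<open>
  A difference of squared distances to two fixed vertices grows only linearly in the distance, by the
  triangle inequality, so the second moment of the distance bounds the second moment of this difference.
\<close>

lemma integrable_sqdist_diff_square: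
  assumes "u \<in> V" "v \<in> V"
  shows "integrable M (\<lambda>s. (real_of_int (sqdist u s - sqdist v s))\<^sup>2)"
proof (rule Bochner_Integration.integrable_bound)
  let ?R = "real (d v u)"
  show "integrable M (\<lambda>s. ?R\<^sup>2 * (8 * real_of_int (sqdist v s) + 2 * ?R\<^sup>2))"
    using integrable_sqdist[OF assms(2)] by (intro integrable_mult_right integrable_add) auto
  show "AE s in M. norm ((real_of_int (sqdist u s - sqdist v s))\<^sup>2) \<le>
      norm (?R\<^sup>2 * (8 * real_of_int (sqdist v s) + 2 * ?R\<^sup>2))"
  proof (rule AE_I2)
    fix s assume "s \<in> space M"
    then have "s \<in> V" by (simp add: space_M)
    then show "norm ((real_of_int (sqdist u s - sqdist v s))\<^sup>2) \<le>
        norm (?R\<^sup>2 * (8 * real_of_int (sqdist v s) + 2 * ?R\<^sup>2))"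
      using dist_square_diff_square_le[OF assms, of s] by (simp add: sqdist_def)
  qed
qed (rule measurable_M)

lemma integral_sqdist_diff:
  assumes "u \<in> V" "v \<in> V"
  shows "(\<integral>s. real_of_int (sqdist u s - sqdist v s) \<partial>M) = moment u - moment v"
  using integrable_sqdist[OF assms(1)] integrable_sqdist[OF assms(2)] by (simp add: moment_def)

text \<open>
  Three walks tie when two differences vanish simultaneously, so this is recurrence in dimension two.
  For more than three vertices it would be a question about walks in higher dimension, which need not
  be recurrent.
\<close>

lemma ties_infinitely_often:
  assumes "v1 \<in> V" "v2 \<in> V" "v3 \<in> V" "moment v2 = moment v1" "moment v3 = moment v1"
  shows "AE \<omega> in S. \<exists>\<^sub>\<infinity>n. walk (sqdist v2) \<omega> n = walk (sqdist v1) \<omega> n \<and> walk (sqdist v3) \<omega> n = walk (sqdist v1) \<omega> n"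
proof -
  have "AE \<omega> in S. \<exists>\<^sub>\<infinity>n. walk (\<lambda>s. sqdist v2 s - sqdist v1 s) \<omega> n = 0 \<and> walk (\<lambda>s. sqdist v3 s - sqdist v1 s) \<omega> n = 0"
    by (intro integer_walk_returns_infinitely_often measurable_M integrable_sqdist_diff_square)
       (use assms in \<open>simp_all add: integral_sqdist_diff del: of_int_diff\<close>)
  then show ?thesis by (simp add: walk_diff)
qed

text \<open>
  The difference of the two walks has a positive drift, and by the strong law its deviation from the
  drift is eventually at most half of it.
\<close>

lemma eventually_larger:
  assumes "u \<in> V" "v \<in> V" "moment v < moment u"
  shows "AE \<omega> in S. \<forall>\<^sub>F n in sequentially. walk (sqdist v) \<omega> n < walk (sqdist u) \<omega> n"
proof -
  define \<delta> where "\<delta> = moment u - moment v"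
  have \<delta>: "\<delta> > 0" using assms by (simp add: \<delta>_def)
  define D where "D s = real_of_int (sqdist u s - sqdist v s)" for s
  have D2: "integrable M (\<lambda>s. (D s)\<^sup>2)"
    unfolding D_def by (rule integrable_sqdist_diff_square[OF assms(1,2)])
  have D1: "integrable M D"
    by (rule M.square_integrable_imp_integrable[OF measurable_M(1) D2])
  have D0: "(\<integral>s. D s \<partial>M) = \<delta>"
    unfolding D_def \<delta>_def by (rule integral_sqdist_diff[OF assms(1,2)])
  have "AE \<omega> in S. \<forall>\<^sub>F n in sequentially. \<bar>walk (\<lambda>s. D s - \<delta>) \<omega> n\<bar> \<le> \<delta> / 2 * n"
  proof (rule walk_sublinear)
    have "(D s - \<delta>)\<^sup>2 = (D s)\<^sup>2 - 2 * \<delta> * D s + \<delta>\<^sup>2" for s by (simp add: power2_diff)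
    then show "integrable M (\<lambda>s. (D s - \<delta>)\<^sup>2)" using D1 D2 by simp
    show "(\<integral>s. D s - \<delta> \<partial>M) = 0" using D1 D0 by (simp add: M.prob_space)
  qed (use \<delta> in auto)
  then show ?thesis
  proof eventually_elim
    case (elim \<omega>)
    then show ?case
      using eventually_gt_at_top[of 0]
    proof eventually_elim
      case (elim n)
      have "walk (\<lambda>s. D s - \<delta>) \<omega> n = real_of_int (walk (sqdist u) \<omega> n) - real_of_int (walk (sqdist v) \<omega> n) - n * \<delta>"
        by (simp add: walk_def D_def sum_subtractf)
      moreover have "0 < \<delta> * n" using elim \<delta> by simp
      ultimately have "real_of_int (walk (sqdist v) \<omega> n) < real_of_int (walk (sqdist u) \<omega> n)"
        using elim by (simp add: abs_le_iff field_simps)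
      then show ?case by simp
    qed
  qed
qed

text \<open>
  The strong law for single vertices does not suffice to compare with infinitely many of them. For
  distant \<open>u\<close> the comparison is uniform: with \<open>r\<close> the distance of \<open>u\<close> and \<open>v\<close>, the difference of the
  squared distances to \<open>s\<close> is at least \<open>r\<^sup>2 - 2 * r * d v s\<close>. Summed over the sample this is
  positive as soon as \<open>r\<close> exceeds twice the average of \<open>d v s\<close>, and that average is eventually at
  most the mean distance plus \<open>1\<close>.
\<close>

lemma eventually_larger_far:
  assumes v: "v \<in> V"
  obtains R where "AE \<omega> in S. \<forall>\<^sub>F n in sequentially. \<forall>u\<in>V. R < d v u \<longrightarrow> walk (sqdist v) \<omega> n < walk (sqdist u) \<omega> n"
proof -
  define D where "D s = real (d v s)" for s
  have D2: "integrable M (\<lambda>s. (D s)\<^sup>2)"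
    using integrable_sqdist[OF v] by (simp add: D_def sqdist_def)
  have D1: "integrable M D"
    by (rule M.square_integrable_imp_integrable[OF measurable_M(1) D2])
  define m where "m = (\<integral>s. D s \<partial>M)"
  have "AE \<omega> in S. \<forall>\<^sub>F n in sequentially. \<bar>walk (\<lambda>s. D s - m) \<omega> n\<bar> \<le> 1 * real n"
  proof (rule walk_sublinear)
    have "(D s - m)\<^sup>2 = (D s)\<^sup>2 - 2 * m * D s + m\<^sup>2" for s by (simp add: power2_diff)
    then show "integrable M (\<lambda>s. (D s - m)\<^sup>2)" using D1 D2 by simp
    show "(\<integral>s. D s - m \<partial>M) = 0" using D1 by (simp add: M.prob_space m_def)
  qed auto
  moreover have "AE \<omega> in S. \<omega> \<in> space S" by simp
  ultimately have "AE \<omega> in S. \<forall>\<^sub>F n in sequentially.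
      \<forall>u\<in>V. nat \<lceil>2 * (m + 1)\<rceil> < d v u \<longrightarrow> walk (sqdist v) \<omega> n < walk (sqdist u) \<omega> n"
  proof eventually_elim
    case (elim \<omega>)
    have \<omega>: "\<omega> i \<in> V" for i using elim(2) by (auto simp: space_PiM space_M)
    show ?case
      using elim(1) eventually_gt_at_top[of 0]
    proof eventually_elim
      case (elim n)
      have "walk (\<lambda>s. D s - m) \<omega> n = walk D \<omega> n - n * m"
        by (simp add: walk_def sum_subtractf)
      with elim have D: "walk D \<omega> n \<le> (m + 1) * n" by (simp add: algebra_simps abs_le_iff)
      show ?case
      proof (intro ballI impI)
        fix u assume u: "u \<in> V" and far: "nat \<lceil>2 * (m + 1)\<rceil> < d v u"
        define r where "r = real (d v u)"
        have r: "2 * (m + 1) < r" "0 < r" using far unfolding r_def by linarith+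
        have "0 < r * n * (r - 2 * (m + 1))" using r elim by simp
        also have "\<dots> = n * r\<^sup>2 - 2 * r * ((m + 1) * n)" by (simp add: algebra_simps power2_eq_square)
        also have "\<dots> \<le> n * r\<^sup>2 - 2 * r * walk D \<omega> n"
          using D r by (intro diff_left_mono mult_left_mono) auto
        also have "\<dots> = (\<Sum>i<n. r\<^sup>2 - 2 * r * D (\<omega> i))"
          by (simp add: walk_def sum_subtractf sum_distrib_left)
        also have "\<dots> \<le> (\<Sum>i<n. real_of_int (sqdist u (\<omega> i)) - real_of_int (sqdist v (\<omega> i)))"
          using dist_square_diff_ge[OF u v \<omega>] by (intro sum_mono) (simp add: r_def D_def sqdist_def)
        also have "\<dots> = real_of_int (walk (sqdist u) \<omega> n - walk (sqdist v) \<omega> n)"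
          by (simp add: walk_def sum_subtractf)
        finally show "walk (sqdist v) \<omega> n < walk (sqdist u) \<omega> n" by linarith
      qed
    qed
  qed
  then show ?thesis by (rule that)
qed

text \<open>
  Far vertices are excluded uniformly, and by local finiteness only finitely many others remain.
\<close>

lemma eventually_minimizers_dominate:
  assumes v: "v \<in> minimizers V E (\<lambda>s. measure M {s})"
  shows "AE \<omega> in S. \<forall>\<^sub>F n in sequentially.
    \<forall>u\<in>V - minimizers V E (\<lambda>s. measure M {s}). walk (sqdist v) \<omega> n < walk (sqdist u) \<omega> n"
proof -
  let ?E = "minimizers V E (\<lambda>s. measure M {s})"
  have vV: "v \<in> V" using v by (simp add: minimizers_def)
  obtain R where far: "AE \<omega> in S. \<forall>\<^sub>F n in sequentially. \<forall>u\<in>V. R < d v u \<longrightarrow> walk (sqdist v) \<omega> n < walk (sqdist u) \<omega> n"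
    using eventually_larger_far[OF vV] .
  let ?B = "{u \<in> V. d v u \<le> R} - ?E"
  have fin: "finite ?B" using finite_ball[OF vV, of R] by simp
  have "AE \<omega> in S. \<forall>\<^sub>F n in sequentially. walk (sqdist v) \<omega> n < walk (sqdist u) \<omega> n" if "u \<in> ?B" for u
    using that v vV unfolding minimizers_eq by (intro eventually_larger) force+
  then have "AE \<omega> in S. \<forall>u\<in>?B. \<forall>\<^sub>F n in sequentially. walk (sqdist v) \<omega> n < walk (sqdist u) \<omega> n"
    using fin by (intro AE_finite_allI)
  with far show ?thesis
  proof eventually_elim
    case (elim \<omega>)
    have "\<forall>\<^sub>F n in sequentially. \<forall>u\<in>?B. walk (sqdist v) \<omega> n < walk (sqdist u) \<omega> n"
      using elim(2) fin by (intro eventually_ball_finite) auto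
    with elim(1) show ?case
      by eventually_elim (auto simp: not_less)
  qed
qed

text \<open>
  A vertex outside the mean-set is eventually beaten by a point of the mean-set. At each of the
  infinitely many late times at which all points of the mean-set tie, these are exactly the minimizers.
\<close>

lemma limsup_sample_mean_set:
  assumes card: "1 \<le> card (minimizers V E (\<lambda>s. measure M {s}))" "card (minimizers V E (\<lambda>s. measure M {s})) \<le> 3"
  shows "AE \<omega> in S. limsup (\<lambda>n. sample_mean_set V E (\<lambda>i. \<omega> (i - 1)) n) = minimizers V E (\<lambda>s. measure M {s})"
proof -
  let ?E = "minimizers V E (\<lambda>s. measure M {s})"
  have "card ?E = 1 \<or> card ?E = 2 \<or> card ?E = 3" using card by linarith
  \<comment> \<open>With fewer than three points, some of \<open>v1\<close>, \<open>v2\<close>, \<open>v3\<close> coincide.\<close>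
  then obtain v1 v2 v3 where E: "?E = {v1, v2, v3}"
    by (auto simp: card_1_singleton_iff card_2_iff card_3_iff)
  then have "v1 \<in> ?E" "v2 \<in> ?E" "v3 \<in> ?E" by auto
  then have vV: "v1 \<in> V" "v2 \<in> V" "v3 \<in> V" and "moment v2 = moment v1" "moment v3 = moment v1"
    unfolding minimizers_eq by (auto intro: antisym)
  then have "AE \<omega> in S. \<exists>\<^sub>\<infinity>n. walk (sqdist v2) \<omega> n = walk (sqdist v1) \<omega> n \<and> walk (sqdist v3) \<omega> n = walk (sqdist v1) \<omega> n"
    by (rule ties_infinitely_often)
  moreover have "AE \<omega> in S. \<forall>\<^sub>F n in sequentially. \<forall>u\<in>V - ?E. walk (sqdist v1) \<omega> n < walk (sqdist u) \<omega> n"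
    by (rule eventually_minimizers_dominate[OF \<open>v1 \<in> ?E\<close>])
  moreover have "AE \<omega> in S. \<omega> \<in> space S" by simp
  ultimately show ?thesis
  proof eventually_elim
    case (elim \<omega>)
    let ?S = "\<lambda>n. sample_mean_set V E (\<lambda>i. \<omega> (i - 1)) n"
    note S_eq = sample_mean_set_eq[OF elim(3)]
    show ?case
    proof (rule set_eqI, unfold mem_limsup_iff)
      fix v
      show "infinite {n. v \<in> ?S n} \<longleftrightarrow> v \<in> ?E"
      proof
        assume inf: "infinite {n. v \<in> ?S n}"
        then have "\<exists>\<^sub>\<infinity>n. v \<in> ?S n" by (simp add: frequently_cofinite)
        then have "\<exists>\<^sub>F n in sequentially. v \<in> ?S n" by (simp add: cofinite_eq_sequentially)
        from frequently_eventually_frequently[OF this eventually_conj[OF elim(2) eventually_ge_at_top[of 1]]]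
        obtain n where n: "v \<in> ?S n" "\<forall>u\<in>V - ?E. walk (sqdist v1) \<omega> n < walk (sqdist u) \<omega> n" "n \<ge> 1"
          by (auto dest: frequently_ex)
        from n(1) have "v \<in> V" "walk (sqdist v) \<omega> n \<le> walk (sqdist v1) \<omega> n"
          unfolding S_eq[OF n(3)] using vV by auto
        with n(2) show "v \<in> ?E" by (meson DiffI not_less)
      next
        assume v: "v \<in> ?E"
        have "\<exists>\<^sub>F n in sequentially. walk (sqdist v2) \<omega> n = walk (sqdist v1) \<omega> n \<and> walk (sqdist v3) \<omega> n = walk (sqdist v1) \<omega> n"
          using elim(1) by (simp add: cofinite_eq_sequentially)
        from frequently_eventually_frequently[OF this eventually_conj[OF elim(2) eventually_ge_at_top[of 1]]]
        have "\<exists>\<^sub>F n in sequentially. v \<in> ?S n"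
        proof (rule frequently_elim1)
          fix n assume n: "(walk (sqdist v2) \<omega> n = walk (sqdist v1) \<omega> n \<and> walk (sqdist v3) \<omega> n = walk (sqdist v1) \<omega> n) \<and>
            (\<forall>u\<in>V - ?E. walk (sqdist v1) \<omega> n < walk (sqdist u) \<omega> n) \<and> 1 \<le> n"
          have tie: "walk (sqdist u) \<omega> n = walk (sqdist v1) \<omega> n" if "u \<in> ?E" for u
            using that n unfolding E by auto
          have "walk (sqdist v) \<omega> n \<le> walk (sqdist u) \<omega> n" if "u \<in> V" for u
          proof (cases "u \<in> ?E")
            case False
            with n that have "walk (sqdist v1) \<omega> n < walk (sqdist u) \<omega> n" by blast
            with tie[OF v] show ?thesis by linarith
          next
            case True
            from tie[OF v] tie[OF True] show ?thesis by linarith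
          qed
          moreover have "v \<in> V" using v by (simp add: minimizers_def)
          moreover have "n \<ge> 1" using n by blast
          ultimately show "v \<in> ?S n" by (simp only: S_eq) blast
        qed
        then show "infinite {n. v \<in> ?S n}"
          by (simp add: frequently_cofinite flip: cofinite_eq_sequentially)
      qed
    qed
  qed
qed

end

section \<open>The upper limit of the sample mean-sets\<close>

theorem theorem3p8:
  fixes V :: "'v set" and E :: "'v rel"
    and P :: "'a measure" and \<xi> :: "nat \<Rightarrow> 'a \<Rightarrow> 'v"
  assumes "graph V E" and "locally_finite_graph V E" and "connected_graph V E"
    and "prob_space P"
    and "\<And>i. i \<ge> 1 \<Longrightarrow> \<xi> i \<in> measurable P (count_space V)"
    and "prob_space.indep_vars P (\<lambda>_. count_space V) \<xi> {1..}"
    and "\<And>i. i \<ge> 1 \<Longrightarrow> distr P (count_space V) (\<xi> i) = distr P (count_space V) (\<xi> 1)"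
    and "totally_defined V E (distribution P (\<xi> 1))"
    and "2 \<le> card (mean_set V E P (\<xi> 1))" and "card (mean_set V E P (\<xi> 1)) \<le> 3"
  shows "AE \<omega> in P. limsup (\<lambda>n. sample_mean_set V E (\<lambda>i. \<xi> i \<omega>) n) = mean_set V E P (\<xi> 1)"
proof -
  interpret \<Omega>: prob_space P by fact
  interpret lf_connected_graph V E by unfold_locales fact+
  let ?C = "count_space V"
  define D where "D = distr P ?C (\<xi> 1)"
  have sets_D: "sets D = sets ?C" by (simp add: D_def)
  have rv: "\<xi> i \<in> measurable P ?C" if "i \<ge> 1" for i using assms(5) that .
  interpret D: prob_space D unfolding D_def by (rule \<Omega>.prob_space_distr[OF rv]) simp
  interpret sequence_space D by unfold_locales
  have dist: "distribution P (\<xi> 1) s = measure D {s}" if "s \<in> V" for s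
    unfolding distribution_def D_def using that rv[of 1]
    by (subst measure_distr) (auto intro!: arg_cong[where f = "measure P"])
  have weight: "weight V E (distribution P (\<xi> 1)) v = weight V E (\<lambda>s. measure D {s}) v" for v
    unfolding weight_def by (intro infsum_cong) (simp only: dist)
  have mean_set: "mean_set V E P (\<xi> 1) = minimizers V E (\<lambda>s. measure D {s})"
    unfolding mean_set_def minimizers_def weight ..
  interpret vertex_sequence_space V E D
  proof
    show "(\<integral>\<^sup>+s. ennreal ((real (graph_dist E v s))\<^sup>2) \<partial>D) < \<infinity>" if "v \<in> V" for v
    proof -
      have "weight V E (\<lambda>s. measure D {s}) v < \<infinity>"
        using assms(8) that unfolding totally_defined_def weight by blast
      then show ?thesis
        unfolding weight_def
        by (subst (asm) infsum_eq_nn_integral[OF countable_vertices sets_D D.finite_measure_axioms]) simp_all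
    qed
  qed (rule sets_D)
  \<comment> \<open>By independence the sample has the law of the coordinate sequence, so almost sure statements transfer.\<close>
  define X where "X \<omega> i = \<xi> (Suc i) \<omega>" for \<omega> i
  let ?Y = "\<lambda>\<omega>. \<lambda>i\<in>{1..}. \<xi> i \<omega>"
  have Y: "?Y \<in> measurable P (\<Pi>\<^sub>M i\<in>{1..}. ?C)"
    using rv by (intro measurable_restrict) auto
  have "distr P (\<Pi>\<^sub>M i\<in>{1..}. ?C) ?Y = (\<Pi>\<^sub>M i\<in>{1..}. distr P ?C (\<xi> i))"
    by (rule \<Omega>.indep_vars_iff_distr_eq_PiM'[THEN iffD1, OF _ _ assms(6)]) (simp_all add: rv)
  also have "\<dots> = (\<Pi>\<^sub>M i\<in>{1..}. D)"
    unfolding D_def by (intro PiM_cong refl assms(7)) simp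
  finally have Y_distr: "distr P (\<Pi>\<^sub>M i\<in>{1..}. ?C) ?Y = (\<Pi>\<^sub>M i\<in>{1::nat..}. D)" .
  let ?t = "\<lambda>\<omega>. \<lambda>n\<in>UNIV. \<omega> (Suc n)"
  have S_sets: "sets (\<Pi>\<^sub>M i\<in>{1::nat..}. D) = sets (\<Pi>\<^sub>M i\<in>{1::nat..}. ?C)"
    by (intro sets_PiM_cong) (simp_all add: sets_D)
  have t: "?t \<in> measurable (\<Pi>\<^sub>M i\<in>{1::nat..}. D) S"
    by (intro measurable_restrict measurable_component_singleton) auto
  have t': "?t \<in> measurable (\<Pi>\<^sub>M i\<in>{1::nat..}. ?C) S"
    using t measurable_cong_sets[OF S_sets refl] by blast
  have X_eq: "X = ?t \<circ> ?Y" by (auto simp: X_def fun_eq_iff)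
  have X: "X \<in> measurable P S"
    unfolding X_eq by (rule measurable_comp[OF Y t'])
  have distr_X: "distr P S X = S"
  proof -
    have "distr P S X = distr (distr P (\<Pi>\<^sub>M i\<in>{1..}. ?C) ?Y) S ?t"
      unfolding X_eq by (rule distr_distr[OF t' Y, symmetric])
    also have "\<dots> = S"
      unfolding Y_distr using distr_PiM_reindex[of "{1..}" "\<lambda>_. D" Suc UNIV] D.prob_space_axioms by simp
    finally show ?thesis .
  qed
  have "AE \<omega> in S. limsup (\<lambda>n. sample_mean_set V E (\<lambda>i. \<omega> (i - 1)) n) = mean_set V E P (\<xi> 1)"
    unfolding mean_set using assms(9,10) unfolding mean_set by (intro limsup_sample_mean_set) auto
  then have "AE \<omega> in distr P S X. limsup (\<lambda>n. sample_mean_set V E (\<lambda>i. \<omega> (i - 1)) n) = mean_set V E P (\<xi> 1)"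
    by (simp only: distr_X)
  then have "AE \<omega> in P. limsup (\<lambda>n. sample_mean_set V E (\<lambda>i. X \<omega> (i - 1)) n) = mean_set V E P (\<xi> 1)"
    by (rule AE_distrD[OF X])
  moreover have "sample_mean_set V E (\<lambda>i. X \<omega> (i - 1)) n = sample_mean_set V E (\<lambda>i. \<xi> i \<omega>) n" for \<omega> n
    by (rule sample_mean_set_cong) (simp add: X_def)
  ultimately show ?thesis by simp
qed

end
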